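(* Let $p$ be a prime, $1\le r\le q<\infty$ and $0\le\beta<1-\frac1q$. Let $$\mathscr{H}f(t)=\int_{\mathbb{Q}_p^*}\frac{f(s)}{|s|_p+|t|_p}\,ds,\qquad t\in\mathbb{Q}_p^*,$$ be the $p$-adic Hilbert operator. Then, for any $f\in C^{\beta}M_{r,q}(\mathbb{Q}_p)$, $$\|\mathscr{H}f\|_{C^{\beta}M_{r,q}(\mathbb{Q}_p)}\le C_{p,\beta,q}\,\|f\|_{C^{\beta}M_{r,q}(\mathbb{Q}_p)},$$ where $C_{p,\beta,q}$ is the (finite) constant $$C_{p,\beta,q}=(1-p^{-1})\sum_{j\in\mathbb{Z}}\frac{p^{j\left(1-\beta-\frac1q\right)}}{1+p^j}.$$
   Context: $\mathbb{Q}_p$ is the field of $p$-adic numbers with the $p$-adic absolute value $|\cdot|_p$, $\mathbb{Q}_p^*=\mathbb{Q}_p\setminus\{0\}$, and $dx$ is the Haar measure on $(\mathbb{Q}_p,+)$ normalized so that $\{x:|x|_p\le 1\}$ has measure $1$; $|E|$ denotes the measure of $E$. For $a\in\mathbb{Q}_p$, $\ell\in\mathbb{Z}$, let $B^\ell(a)=\{x\in\mathbb{Q}_p:|x-a|_p\le p^\ell\}$, so $|B^\ell(a)|=p^\ell$. For $1\le r\le q<\infty$ and $0\le\beta<1$, the fractional Cesàro–Morrey space $C^{\beta}M_{r,q}(\mathbb{Q}_p)$ consists of all locally integrable functions $f$ on $\mathbb{Q}_p$ with $\|f\|_{C^{\beta}M_{r,q}(\mathbb{Q}_p)}<\infty$,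 where for measurable $f$ (with values in $[0,\infty]$) $$\|f\|_{C^{\beta}M_{r,q}(\mathbb{Q}_p)}=\sup_{a\in\mathbb{Q}_p,\ \ell\in\mathbb{Z}}|B^\ell(a)|^{\frac1q-\frac1r}\left(\int_{B^\ell(a)}\left(\frac{1}{|x|_p^{1-\beta}}\int_{|t|_p\le|x|_p}|f(t)|\,dt\right)^r dx\right)^{1/r}.$$ *)

theory Defs
  imports "HOL-Analysis.Analysis" "HOL-Computational_Algebra.Squarefree"
    "Berlekamp_Zassenhaus.Finite_Field"
begin

definition rat_padic_abs :: "nat \<Rightarrow> rat \<Rightarrow> real" where
  "rat_padic_abs p x =
     (if x = 0 then 0
      else real p powi (int (multiplicity (int p) (snd (quotient_of x)))
                        - int (multiplicity (int p) (fst (quotient_of x)))))"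

lemma rat_padic_abs_0 [simp]: "rat_padic_abs p 0 = 0"
  by (simp add: rat_padic_abs_def)

lemma rat_padic_abs_frac:
  assumes p: "prime p" and a: "a \<noteq> 0" and b: "b \<noteq> 0"
  shows "rat_padic_abs p (of_int a / of_int b) =
           real p powi (int (multiplicity (int p) b) - int (multiplicity (int p) a))"
proof -
  obtain c d where cd: "quotient_of (of_int a / of_int b) = (c, d)"
    by (metis surj_pair)
  have d: "d > 0" using quotient_of_denom_pos[OF cd] .
  have eq: "(of_int a / of_int b :: rat) = of_int c / of_int d"
    using quotient_of_div[OF cd] .
  have "(of_int (a * d) :: rat) = of_int (c * b)"
    using eq b d by (simp add: field_simps)
  then have eq': "a * d = c * b"
    by (simp only: of_int_eq_iff)
  have c: "c \<noteq> 0" using eq' a d by auto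
  have pe: "prime_elem (int p)" using p by auto
  have "multiplicity (int p) a + multiplicity (int p) d
      = multiplicity (int p) c + multiplicity (int p) b"
    using eq' prime_elem_multiplicity_mult_distrib[OF pe a, of d]
      prime_elem_multiplicity_mult_distrib[OF pe c b] d by simp
  then have "int (multiplicity (int p) d) - int (multiplicity (int p) c)
           = int (multiplicity (int p) b) - int (multiplicity (int p) a)"
    by linarith
  with a b cd show ?thesis
    by (simp add: rat_padic_abs_def)
qed

lemma rat_as_frac:
  obtains a b :: int where "(x :: rat) = of_int a / of_int b" "b \<noteq> 0"
  by (metis quotient_of_denom_pos quotient_of_div less_irrefl surj_pair)

lemma rat_padic_abs_nonneg [simp]: "0 \<le> rat_padic_abs p x"
  by (simp add: rat_padic_abs_def)

lemma rat_padic_abs_eq_0: "prime p \<Longrightarrow> rat_padic_abs p x = 0 \<longleftrightarrow> x = 0"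
  by (auto simp: rat_padic_abs_def dest: prime_gt_0_nat)

lemma rat_padic_abs_1 [simp]: "rat_padic_abs p 1 = 1"
  by (simp add: rat_padic_abs_def)

lemma rat_padic_abs_mult:
  assumes p: "prime p"
  shows "rat_padic_abs p (x * y) = rat_padic_abs p x * rat_padic_abs p y"
proof (cases "x = 0 \<or> y = 0")
  case False
  obtain a b :: int where x: "x = of_int a / of_int b" "b \<noteq> 0" by (rule rat_as_frac)
  obtain c d :: int where y: "y = of_int c / of_int d" "d \<noteq> 0" by (rule rat_as_frac)
  have nz: "a \<noteq> 0" "c \<noteq> 0" using False x y by auto
  have pe: "prime_elem (int p)" using p by auto
  have p0: "real p \<noteq> 0" using prime_gt_0_nat[OF p] by simp
  have xy: "x * y = of_int (a * c) / of_int (b * d)" using x y by simp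
  have "rat_padic_abs p (x * y) = real p powi
      ((int (multiplicity (int p) b) - int (multiplicity (int p) a)) +
       (int (multiplicity (int p) d) - int (multiplicity (int p) c)))"
    unfolding xy using p nz x(2) y(2)
    by (subst rat_padic_abs_frac)
      (auto simp: prime_elem_multiplicity_mult_distrib[OF pe] algebra_simps)
  also have "\<dots> = rat_padic_abs p x * rat_padic_abs p y"
    unfolding x(1) y(1) using p nz x(2) y(2) p0
    by (simp add: rat_padic_abs_frac power_int_add)
  finally show ?thesis .
qed auto

lemma rat_padic_abs_minus [simp]: "rat_padic_abs p (- x) = rat_padic_abs p x"
  by (simp add: rat_padic_abs_def rat_uminus_code split_beta)

lemma rat_padic_abs_minus_commute: "rat_padic_abs p (x - y) = rat_padic_abs p (y - x)"
  by (metis minus_diff_eq rat_padic_abs_minus)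

lemma rat_padic_abs_ultrametric:
  assumes p: "prime p"
  shows "rat_padic_abs p (x + y) \<le> max (rat_padic_abs p x) (rat_padic_abs p y)"
proof (cases "x = 0 \<or> y = 0 \<or> x + y = 0")
  case False
  obtain a b :: int where x: "x = of_int a / of_int b" "b \<noteq> 0" by (rule rat_as_frac)
  obtain c d :: int where y: "y = of_int c / of_int d" "d \<noteq> 0" by (rule rat_as_frac)
  define u where "u = a * d"
  define v where "v = c * b"
  define w where "w = b * d"
  let ?m = "multiplicity (int p)"
  have xu: "x = of_int u / of_int w" and yv: "y = of_int v / of_int w" and w: "w \<noteq> 0"
    using x y by (auto simp: u_def v_def w_def)
  have s: "x + y = of_int (u + v) / of_int w"
    unfolding xu yv by (simp add: add_divide_distrib)
  have nz: "u \<noteq> 0" "v \<noteq> 0" "u + v \<noteq> 0" using False xu yv s by auto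
  have p1: "real p \<ge> 1" using prime_ge_1_nat[OF p] by simp
  have "int p ^ min (?m u) (?m v) dvd u + v"
    by (intro dvd_add multiplicity_dvd') auto
  then have "min (?m u) (?m v) \<le> ?m (u + v)"
    using nz p by (intro multiplicity_geI) (auto dest: prime_gt_1_nat)
  then have "int (?m w) - int (?m (u + v)) \<le> max (int (?m w) - int (?m u)) (int (?m w) - int (?m v))"
    by linarith
  then have "real p powi (int (?m w) - int (?m (u + v)))
      \<le> real p powi (max (int (?m w) - int (?m u)) (int (?m w) - int (?m v)))"
    using p1 by (rule power_int_increasing)
  also have "\<dots> \<le> max (real p powi (int (?m w) - int (?m u))) (real p powi (int (?m w) - int (?m v)))"
    by (auto simp: max_def)
  finally show ?thesis
    unfolding s unfolding xu yv using p nz w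
    by (simp add: rat_padic_abs_frac del: of_int_add)
qed (auto simp: le_max_iff_disj)

lemma rat_padic_abs_triangle:
  "prime p \<Longrightarrow> rat_padic_abs p (x + y) \<le> rat_padic_abs p x + rat_padic_abs p y"
  using rat_padic_abs_ultrametric[of p x y] rat_padic_abs_nonneg[of p x] rat_padic_abs_nonneg[of p y]
  by linarith

lemma rat_padic_abs_diff_triangle:
  assumes "prime p"
  shows "\<bar>rat_padic_abs p x - rat_padic_abs p y\<bar> \<le> rat_padic_abs p (x - y)"
  using rat_padic_abs_triangle[OF assms, of "x - y" y] rat_padic_abs_triangle[OF assms, of "y - x" x]
    rat_padic_abs_minus_commute[of p x y]
  by simp

definition padic_null :: "nat \<Rightarrow> (nat \<Rightarrow> rat) \<Rightarrow> bool" where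
  "padic_null p X \<longleftrightarrow> (\<lambda>n. rat_padic_abs p (X n)) \<longlonglongrightarrow> 0"

definition padic_Cauchy :: "nat \<Rightarrow> (nat \<Rightarrow> rat) \<Rightarrow> bool" where
  "padic_Cauchy p X \<longleftrightarrow>
     (\<forall>e>0. \<exists>N. \<forall>m\<ge>N. \<forall>n\<ge>N. rat_padic_abs p (X m - X n) < e)"

lemma padic_null_bound:
  assumes "padic_null p Y" and "\<And>n. rat_padic_abs p (X n) \<le> C * rat_padic_abs p (Y n)"
  shows "padic_null p X"
proof -
  have "(\<lambda>n. C * rat_padic_abs p (Y n)) \<longlonglongrightarrow> 0"
    using tendsto_mult_left[OF assms(1)[unfolded padic_null_def], of C] by simp
  then show ?thesis unfolding padic_null_def
    by (rule tendsto_sandwich[rotated 3, OF _ ]) (use assms(2) in auto)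
qed

lemma padic_null_0 [simp]: "padic_null p (\<lambda>n. 0)"
  by (simp add: padic_null_def)

lemma padic_null_minus: "padic_null p X \<Longrightarrow> padic_null p (\<lambda>n. - X n)"
  by (simp add: padic_null_def)

lemma padic_null_add:
  assumes "prime p" "padic_null p X" "padic_null p Y"
  shows "padic_null p (\<lambda>n. X n + Y n)"
proof -
  have "(\<lambda>n. rat_padic_abs p (X n) + rat_padic_abs p (Y n)) \<longlonglongrightarrow> 0"
    using tendsto_add[OF assms(2,3)[unfolded padic_null_def]] by simp
  then show ?thesis unfolding padic_null_def
    by (rule tendsto_sandwich[rotated 3]) (use rat_padic_abs_triangle[OF assms(1)] in auto)
qed

lemma padic_Cauchy_const [simp]: "padic_Cauchy p (\<lambda>n. c)"
  by (simp add: padic_Cauchy_def)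

lemma padic_Cauchy_minus: "padic_Cauchy p X \<Longrightarrow> padic_Cauchy p (\<lambda>n. - X n)"
  unfolding padic_Cauchy_def by (simp add: rat_padic_abs_minus_commute add.commute)

lemma padic_Cauchy_add:
  assumes p: "prime p" and X: "padic_Cauchy p X" and Y: "padic_Cauchy p Y"
  shows "padic_Cauchy p (\<lambda>n. X n + Y n)"
  unfolding padic_Cauchy_def
proof (intro allI impI)
  fix e :: real assume e: "e > 0"
  obtain M where M: "\<forall>m\<ge>M. \<forall>n\<ge>M. rat_padic_abs p (X m - X n) < e"
    using X e unfolding padic_Cauchy_def by blast
  obtain N where N: "\<forall>m\<ge>N. \<forall>n\<ge>N. rat_padic_abs p (Y m - Y n) < e"
    using Y e unfolding padic_Cauchy_def by blast
  show "\<exists>K. \<forall>m\<ge>K. \<forall>n\<ge>K. rat_padic_abs p (X m + Y m - (X n + Y n)) < e"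
  proof (intro exI[of _ "max M N"] allI impI)
    fix m n assume mn: "max M N \<le> m" "max M N \<le> n"
    have "rat_padic_abs p ((X m - X n) + (Y m - Y n)) < e"
      using rat_padic_abs_ultrametric[OF p, of "X m - X n" "Y m - Y n"] M N mn
      by (smt (verit) max.bounded_iff)
    then show "rat_padic_abs p (X m + Y m - (X n + Y n)) < e"
      by (simp add: algebra_simps)
  qed
qed

lemma padic_Cauchy_abs:
  assumes p: "prime p" and X: "padic_Cauchy p X"
  shows "convergent (\<lambda>n. rat_padic_abs p (X n))"
proof -
  have "Cauchy (\<lambda>n. rat_padic_abs p (X n))"
    unfolding Cauchy_def dist_real_def
    using X rat_padic_abs_diff_triangle[OF p] unfolding padic_Cauchy_def
    by (meson order_le_less_trans)
  then show ?thesis by (rule Cauchy_convergent)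
qed

lemma padic_Cauchy_bounded:
  assumes p: "prime p" and X: "padic_Cauchy p X"
  obtains B where "B > 0" "\<And>n. rat_padic_abs p (X n) \<le> B"
proof -
  have "Bseq (\<lambda>n. rat_padic_abs p (X n))"
    using padic_Cauchy_abs[OF p X] by (rule convergent_imp_Bseq)
  then show thesis
    using that by (auto elim!: BseqE)
qed

lemma padic_Cauchy_mult:
  assumes p: "prime p" and X: "padic_Cauchy p X" and Y: "padic_Cauchy p Y"
  shows "padic_Cauchy p (\<lambda>n. X n * Y n)"
  unfolding padic_Cauchy_def
proof (intro allI impI)
  fix e :: real assume e: "e > 0"
  obtain A where A: "A > 0" "\<And>n. rat_padic_abs p (X n) \<le> A" using padic_Cauchy_bounded[OF p X] by blast
  obtain B where B: "B > 0" "\<And>n. rat_padic_abs p (Y n) \<le> B" using padic_Cauchy_bounded[OF p Y] by blast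
  obtain M where M: "\<forall>m\<ge>M. \<forall>n\<ge>M. rat_padic_abs p (X m - X n) < e / B"
    using X e B unfolding padic_Cauchy_def by (meson divide_pos_pos)
  obtain N where N: "\<forall>m\<ge>N. \<forall>n\<ge>N. rat_padic_abs p (Y m - Y n) < e / A"
    using Y e A unfolding padic_Cauchy_def by (meson divide_pos_pos)
  show "\<exists>K. \<forall>m\<ge>K. \<forall>n\<ge>K. rat_padic_abs p (X m * Y m - X n * Y n) < e"
  proof (intro exI[of _ "max M N"] allI impI)
    fix m n assume mn: "max M N \<le> m" "max M N \<le> n"
    have 1: "rat_padic_abs p (X m * (Y m - Y n)) < e"
    proof -
      have "rat_padic_abs p (X m * (Y m - Y n)) \<le> A * rat_padic_abs p (Y m - Y n)"
        using A by (simp add: rat_padic_abs_mult[OF p] mult_right_mono)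
      also have "\<dots> < A * (e / A)"
        using N mn A by (intro mult_strict_left_mono) auto
      finally show ?thesis using A by simp
    qed
    have 2: "rat_padic_abs p ((X m - X n) * Y n) < e"
    proof -
      have "rat_padic_abs p ((X m - X n) * Y n) \<le> rat_padic_abs p (X m - X n) * B"
        using B by (simp add: rat_padic_abs_mult[OF p] mult_left_mono)
      also have "\<dots> < (e / B) * B"
        using M mn B by (intro mult_strict_right_mono) auto
      finally show ?thesis using B by simp
    qed
    have "X m * Y m - X n * Y n = X m * (Y m - Y n) + (X m - X n) * Y n"
      by (simp add: algebra_simps)
    then show "rat_padic_abs p (X m * Y m - X n * Y n) < e"
      using rat_padic_abs_ultrametric[OF p, of "X m * (Y m - Y n)" "(X m - X n) * Y n"] 1 2
      by simp
  qed
qed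

lemma padic_Cauchy_not_null:
  assumes p: "prime p" and X: "padic_Cauchy p X" and nz: "\<not> padic_null p X"
  obtains b N where "b > 0" "\<And>n. n \<ge> N \<Longrightarrow> b < rat_padic_abs p (X n)"
proof -
  obtain L where L: "(\<lambda>n. rat_padic_abs p (X n)) \<longlonglongrightarrow> L"
    using padic_Cauchy_abs[OF p X] unfolding convergent_def by blast
  have "L \<ge> 0" using LIMSEQ_le_const[OF L] by auto
  moreover have "L \<noteq> 0" using nz L unfolding padic_null_def by auto
  ultimately have L0: "L > 0" by simp
  then have "eventually (\<lambda>n. L / 2 < rat_padic_abs p (X n)) sequentially"
    using order_tendstoD(1)[OF L, of "L / 2"] by simp
  then obtain N where "\<And>n. n \<ge> N \<Longrightarrow> L / 2 < rat_padic_abs p (X n)"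
    unfolding eventually_sequentially by blast
  with L0 show thesis by (intro that[of "L / 2"]) auto
qed

lemma rat_padic_abs_inverse:
  assumes p: "prime p"
  shows "rat_padic_abs p (inverse x) = inverse (rat_padic_abs p x)"
proof (cases "x = 0")
  case False
  then have "rat_padic_abs p x * rat_padic_abs p (inverse x) = 1"
    by (simp flip: rat_padic_abs_mult[OF p])
  then show ?thesis by (metis inverse_unique)
qed simp

lemma rat_padic_abs_inverse_diff:
  assumes p: "prime p" and b: "b > 0" "b < rat_padic_abs p x" and c: "c > 0" "c < rat_padic_abs p y"
  shows "rat_padic_abs p (inverse x - inverse y) \<le> rat_padic_abs p (x - y) / (b * c)"
proof -
  have nz: "x \<noteq> 0" "y \<noteq> 0" using b c by auto
  have "rat_padic_abs p (inverse x - inverse y)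
      = rat_padic_abs p (x - y) / (rat_padic_abs p x * rat_padic_abs p y)"
    using nz by (simp add: inverse_diff_inverse rat_padic_abs_mult[OF p] rat_padic_abs_inverse[OF p]
        divide_inverse)
  also have "\<dots> \<le> rat_padic_abs p (x - y) / (b * c)"
    using b c by (intro divide_left_mono mult_mono) auto
  finally show ?thesis .
qed

lemma padic_Cauchy_inverse:
  assumes p: "prime p" and X: "padic_Cauchy p X" and nz: "\<not> padic_null p X"
  shows "padic_Cauchy p (\<lambda>n. inverse (X n))"
  unfolding padic_Cauchy_def
proof (intro allI impI)
  fix e :: real assume e: "e > 0"
  obtain b M where b: "b > 0" "\<And>n. n \<ge> M \<Longrightarrow> b < rat_padic_abs p (X n)"
    using padic_Cauchy_not_null[OF p X nz] by metis
  obtain N where N: "\<forall>m\<ge>N. \<forall>n\<ge>N. rat_padic_abs p (X m - X n) < e * (b * b)"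
    using X e b unfolding padic_Cauchy_def by (meson mult_pos_pos)
  show "\<exists>K. \<forall>m\<ge>K. \<forall>n\<ge>K. rat_padic_abs p (inverse (X m) - inverse (X n)) < e"
  proof (intro exI[of _ "max M N"] allI impI)
    fix m n assume mn: "max M N \<le> m" "max M N \<le> n"
    have "rat_padic_abs p (inverse (X m) - inverse (X n)) \<le> rat_padic_abs p (X m - X n) / (b * b)"
      using b mn by (intro rat_padic_abs_inverse_diff[OF p]) auto
    also have "\<dots> < e" using N mn b by (simp add: divide_less_eq)
    finally show "rat_padic_abs p (inverse (X m) - inverse (X n)) < e" .
  qed
qed

lemma padic_null_inverse_diff:
  assumes p: "prime p"
    and X: "padic_Cauchy p X" "\<not> padic_null p X"
    and Y: "padic_Cauchy p Y" "\<not> padic_null p Y"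
    and XY: "padic_null p (\<lambda>n. X n - Y n)"
  shows "padic_null p (\<lambda>n. inverse (X n) - inverse (Y n))"
proof -
  obtain b M where b: "b > 0" "\<And>n. n \<ge> M \<Longrightarrow> b < rat_padic_abs p (X n)"
    using padic_Cauchy_not_null[OF p X] by metis
  obtain c N where c: "c > 0" "\<And>n. n \<ge> N \<Longrightarrow> c < rat_padic_abs p (Y n)"
    using padic_Cauchy_not_null[OF p Y] by metis
  have lim: "(\<lambda>n. rat_padic_abs p (X n - Y n) / (b * c)) \<longlonglongrightarrow> 0"
    using tendsto_divide[OF XY[unfolded padic_null_def] tendsto_const[of "b * c"]] b c by simp
  have "eventually (\<lambda>n. rat_padic_abs p (inverse (X n) - inverse (Y n))
      \<le> rat_padic_abs p (X n - Y n) / (b * c)) sequentially"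
    unfolding eventually_sequentially
    using b c rat_padic_abs_inverse_diff[OF p] by (intro exI[of _ "max M N"]) auto
  then show ?thesis unfolding padic_null_def
    by (intro tendsto_sandwich[OF _ _ tendsto_const lim]) auto
qed

lemma padic_null_diff_Cauchy_iff:
  assumes p: "prime p" and XY: "padic_null p (\<lambda>n. X n - Y n)"
  shows "padic_null p X \<longleftrightarrow> padic_null p Y"
  using padic_null_add[OF p XY, of Y] padic_null_add[OF p padic_null_minus[OF XY], of X] by auto

lemma padic_null_mult:
  assumes p: "prime p" and X: "padic_Cauchy p X" and Y: "padic_null p Y"
  shows "padic_null p (\<lambda>n. X n * Y n)"
proof -
  obtain A where A: "A > 0" "\<And>n. rat_padic_abs p (X n) \<le> A" using padic_Cauchy_bounded[OF p X] by blast
  show ?thesis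
    using A by (intro padic_null_bound[OF Y, of _ A]) (simp add: rat_padic_abs_mult[OF p] mult_right_mono)
qed

lemma prime_CARD: "prime CARD('p::prime_card)"
  by (rule prime_card)

text \<open>
  The prime enters through the cardinality of the index type:
  \<open>'p padic\<close> is the completion of the rationals with respect to the p-adic absolute value for
  p = \<open>CARD('p)\<close>, that is, Cauchy sequences modulo null sequences.  Every prime is the
  cardinality of some type.
\<close>

definition padic_rel :: "'p::prime_card itself \<Rightarrow> (nat \<Rightarrow> rat) \<Rightarrow> (nat \<Rightarrow> rat) \<Rightarrow> bool" where
  "padic_rel T X Y \<longleftrightarrow> padic_Cauchy CARD('p) X \<and> padic_Cauchy CARD('p) Y \<and>
     padic_null CARD('p) (\<lambda>n. X n - Y n)"

lemma part_equivp_padic_rel: "part_equivp (padic_rel TYPE('p::prime_card))"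
proof (rule part_equivpI)
  show "\<exists>X. padic_rel TYPE('p) X X"
    by (rule exI[of _ "\<lambda>n. 0"]) (simp add: padic_rel_def)
  show "symp (padic_rel TYPE('p))"
    unfolding symp_def padic_rel_def padic_null_def
    by (auto simp: rat_padic_abs_minus_commute)
  show "transp (padic_rel TYPE('p))"
  proof (rule transpI)
    fix X Y Z assume "padic_rel TYPE('p) X Y" "padic_rel TYPE('p) Y Z"
    then show "padic_rel TYPE('p) X Z"
      unfolding padic_rel_def
      using padic_null_add[OF prime_CARD[where 'p='p], of "\<lambda>n. X n - Y n" "\<lambda>n. Y n - Z n"] by simp
  qed
qed

text \<open>\<open>quotient_type\<close> does not accept sort constraints, hence the explicit construction.\<close>

typedef ('p::prime_card) padic =
    "{c. \<exists>X. padic_rel TYPE('p) X X \<and> c = Collect (padic_rel TYPE('p) X)}"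
  morphisms padic_class Abs_padic
proof -
  have "padic_rel TYPE('p) (\<lambda>n. 0) (\<lambda>n. 0)" by (simp add: padic_rel_def)
  then show ?thesis by blast
qed

definition padic_of_seq :: "(nat \<Rightarrow> rat) \<Rightarrow> 'p::prime_card padic" where
  "padic_of_seq X = Abs_padic (Collect (padic_rel TYPE('p) X))"

definition cr_padic :: "(nat \<Rightarrow> rat) \<Rightarrow> 'p::prime_card padic \<Rightarrow> bool" where
  "cr_padic X x \<longleftrightarrow> padic_rel TYPE('p) X X \<and> padic_of_seq X = x"

definition padic_rep :: "'p::prime_card padic \<Rightarrow> nat \<Rightarrow> rat" where
  "padic_rep x = (SOME X. X \<in> padic_class x)"

lemma Quotient_padic:
  "Quotient (padic_rel TYPE('p)) (padic_of_seq :: _ \<Rightarrow> 'p::prime_card padic) padic_rep cr_padic"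
proof -
  have qt: "quot_type (padic_rel TYPE('p)) (Abs_padic :: _ \<Rightarrow> 'p padic) padic_class"
    by (rule quot_type.intro[OF part_equivp_padic_rel])
      (use padic_class padic_class_inverse Abs_padic_inverse padic_class_inject in blast)+
  have "padic_of_seq = quot_type.abs (padic_rel TYPE('p)) (Abs_padic :: _ \<Rightarrow> 'p padic)"
    and "padic_rep = quot_type.rep (padic_class :: 'p padic \<Rightarrow> _)"
    by (simp_all add: fun_eq_iff padic_of_seq_def padic_rep_def
        quot_type.abs_def[OF qt] quot_type.rep_def[OF qt])
  with quot_type.Quotient[OF qt]
  have "Quotient3 (padic_rel TYPE('p)) (padic_of_seq :: _ \<Rightarrow> 'p padic) padic_rep"
    by simp
  then show ?thesis
    by (rule Quotient3_to_Quotient) (simp add: cr_padic_def fun_eq_iff atomize_eq)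
qed

setup_lifting Quotient_padic

instantiation padic :: (prime_card) field
begin

lift_definition zero_padic :: "'a padic" is "\<lambda>n. 0"
  by (simp add: padic_rel_def)

lift_definition one_padic :: "'a padic" is "\<lambda>n. 1"
  by (simp add: padic_rel_def)

lift_definition plus_padic :: "'a padic \<Rightarrow> 'a padic \<Rightarrow> 'a padic" is "\<lambda>X Y n. X n + Y n"
  unfolding padic_rel_def
  using padic_Cauchy_add[OF prime_CARD] padic_null_add[OF prime_CARD]
  by (force simp: add_diff_add)

lift_definition uminus_padic :: "'a padic \<Rightarrow> 'a padic" is "\<lambda>X n. - X n"
  unfolding padic_rel_def
  using padic_Cauchy_minus padic_null_minus by (force simp: minus_diff_minus)

lift_definition times_padic :: "'a padic \<Rightarrow> 'a padic \<Rightarrow> 'a padic" is "\<lambda>X Y n. X n * Y n"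
proof -
  fix X X' Y Y' :: "nat \<Rightarrow> rat"
  assume a: "padic_rel TYPE('a) X X'" "padic_rel TYPE('a) Y Y'"
  have "padic_null CARD('a) (\<lambda>n. X n * (Y n - Y' n) + Y' n * (X n - X' n))"
    using a unfolding padic_rel_def
    by (intro padic_null_add[OF prime_CARD] padic_null_mult[OF prime_CARD]) auto
  then show "padic_rel TYPE('a) (\<lambda>n. X n * Y n) (\<lambda>n. X' n * Y' n)"
    using a unfolding padic_rel_def
    by (auto simp: algebra_simps intro: padic_Cauchy_mult[OF prime_CARD])
qed

lift_definition inverse_padic :: "'a padic \<Rightarrow> 'a padic"
  is "\<lambda>X. if padic_null CARD('a) X then (\<lambda>n. 0) else (\<lambda>n. inverse (X n))"
proof -
  fix X Y :: "nat \<Rightarrow> rat"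
  assume a: "padic_rel TYPE('a) X Y"
  then have "padic_null CARD('a) X \<longleftrightarrow> padic_null CARD('a) Y"
    unfolding padic_rel_def using padic_null_diff_Cauchy_iff[OF prime_CARD] by blast
  with a show "padic_rel TYPE('a)
      (if padic_null CARD('a) X then \<lambda>n. 0 else (\<lambda>n. inverse (X n)))
      (if padic_null CARD('a) Y then \<lambda>n. 0 else (\<lambda>n. inverse (Y n)))"
    unfolding padic_rel_def
    by (auto intro: padic_Cauchy_inverse[OF prime_CARD] padic_null_inverse_diff[OF prime_CARD])
qed

definition minus_padic :: "'a padic \<Rightarrow> 'a padic \<Rightarrow> 'a padic" where
  "minus_padic x y = x + - y"

definition divide_padic :: "'a padic \<Rightarrow> 'a padic \<Rightarrow> 'a padic" where
  "divide_padic x y = x * inverse y"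

instance
proof
  fix x y z :: "'a padic"
  show "x + y + z = x + (y + z)"
    by transfer (auto simp: padic_rel_def algebra_simps intro!: padic_Cauchy_add[OF prime_CARD])
  show "x + y = y + x"
    by transfer (auto simp: padic_rel_def algebra_simps intro!: padic_Cauchy_add[OF prime_CARD])
  show "0 + x = x"
    by transfer (auto simp: padic_rel_def)
  show "- x + x = 0"
    by transfer (auto simp: padic_rel_def)
  show "x - y = x + - y"
    by (rule minus_padic_def)
  show "x * y * z = x * (y * z)"
    by transfer (auto simp: padic_rel_def algebra_simps intro!: padic_Cauchy_mult[OF prime_CARD])
  show "x * y = y * x"
    by transfer (auto simp: padic_rel_def algebra_simps intro!: padic_Cauchy_mult[OF prime_CARD])
  show "1 * x = x"
    by transfer (auto simp: padic_rel_def)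
  show "(x + y) * z = x * z + y * z"
    by transfer (auto simp: padic_rel_def algebra_simps
        intro!: padic_Cauchy_mult[OF prime_CARD] padic_Cauchy_add[OF prime_CARD])
  show "(0 :: 'a padic) \<noteq> 1"
    by transfer (auto simp: padic_rel_def padic_null_def LIMSEQ_const_iff)
  show "x \<noteq> 0 \<Longrightarrow> inverse x * x = 1"
  proof transfer
    fix X :: "nat \<Rightarrow> rat"
    assume X: "padic_rel TYPE('a) X X" "\<not> padic_rel TYPE('a) X (\<lambda>n. 0)"
    then have C: "padic_Cauchy CARD('a) X" and nz: "\<not> padic_null CARD('a) X"
      by (auto simp: padic_rel_def)
    obtain b N where b: "b > 0" "\<And>n. n \<ge> N \<Longrightarrow> b < rat_padic_abs CARD('a) (X n)"
      using padic_Cauchy_not_null[OF prime_CARD C nz] by metis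
    have "X n \<noteq> 0" if "n \<ge> N" for n
      using b(1) b(2)[OF that] by auto
    then have "eventually (\<lambda>n. rat_padic_abs CARD('a) (inverse (X n) * X n - 1) = 0) sequentially"
      unfolding eventually_sequentially by (intro exI[of _ N]) auto
    then have "padic_null CARD('a) (\<lambda>n. inverse (X n) * X n - 1)"
      unfolding padic_null_def by (rule tendsto_eventually)
    with C nz show "padic_rel TYPE('a)
        (\<lambda>n. (if padic_null CARD('a) X then \<lambda>n. 0 else (\<lambda>n. inverse (X n))) n * X n) (\<lambda>n. 1)"
      by (auto simp: padic_rel_def
          intro!: padic_Cauchy_mult[OF prime_CARD] padic_Cauchy_inverse[OF prime_CARD])
  qed
  show "x div y = x * inverse y"
    by (rule divide_padic_def)
  show "inverse (0 :: 'a padic) = 0"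
    by transfer (auto simp: padic_rel_def)
qed

end

lift_definition padic_abs :: "'p::prime_card padic \<Rightarrow> real"
  is "\<lambda>X. lim (\<lambda>n. rat_padic_abs CARD('p) (X n))"
proof -
  fix X Y :: "nat \<Rightarrow> rat"
  assume a: "padic_rel TYPE('p) X Y"
  then obtain L where L: "(\<lambda>n. rat_padic_abs CARD('p) (Y n)) \<longlonglongrightarrow> L"
    unfolding padic_rel_def using padic_Cauchy_abs[OF prime_CARD] convergent_def by blast
  have "(\<lambda>n. rat_padic_abs CARD('p) (X n) - rat_padic_abs CARD('p) (Y n)) \<longlonglongrightarrow> 0"
  proof (rule Lim_null_comparison)
    show "(\<lambda>n. rat_padic_abs CARD('p) (X n - Y n)) \<longlonglongrightarrow> 0"
      using a by (simp add: padic_rel_def padic_null_def)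
  qed (simp add: rat_padic_abs_diff_triangle[OF prime_CARD])
  then have "(\<lambda>n. rat_padic_abs CARD('p) (X n)) \<longlonglongrightarrow> L"
    using tendsto_add[OF _ L] by fastforce
  with L show "lim (\<lambda>n. rat_padic_abs CARD('p) (X n)) = lim (\<lambda>n. rat_padic_abs CARD('p) (Y n))"
    by (simp add: limI)
qed

lemma padic_abs_lim:
  assumes "padic_rel TYPE('p::prime_card) X X"
  shows "(\<lambda>n. rat_padic_abs CARD('p) (X n)) \<longlonglongrightarrow> lim (\<lambda>n. rat_padic_abs CARD('p) (X n))"
  using assms padic_Cauchy_abs[OF prime_CARD] unfolding padic_rel_def convergent_LIMSEQ_iff by blast

lemma padic_abs_eq_0_iff: "padic_abs (x :: 'p::prime_card padic) = 0 \<longleftrightarrow> x = 0"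
proof transfer
  fix X :: "nat \<Rightarrow> rat"
  assume X: "padic_rel TYPE('p) X X"
  have "padic_null CARD('p) X \<longleftrightarrow> lim (\<lambda>n. rat_padic_abs CARD('p) (X n)) = 0"
    using padic_abs_lim[OF X] unfolding padic_null_def by (metis limI)
  with X show "(lim (\<lambda>n. rat_padic_abs CARD('p) (X n)) = 0) = padic_rel TYPE('p) X (\<lambda>n. 0)"
    by (auto simp: padic_rel_def)
qed

lemma padic_abs_minus: "padic_abs (- x :: 'p::prime_card padic) = padic_abs x"
  by transfer simp

lemma padic_abs_mult: "padic_abs (x * y :: 'p::prime_card padic) = padic_abs x * padic_abs y"
proof transfer
  fix X Y :: "nat \<Rightarrow> rat"
  assume "padic_rel TYPE('p) X X" "padic_rel TYPE('p) Y Y"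
  from tendsto_mult[OF this[THEN padic_abs_lim]]
  show "lim (\<lambda>n. rat_padic_abs CARD('p) (X n * Y n)) =
      lim (\<lambda>n. rat_padic_abs CARD('p) (X n)) * lim (\<lambda>n. rat_padic_abs CARD('p) (Y n))"
    by (simp add: rat_padic_abs_mult[OF prime_CARD] limI)
qed

lemma padic_abs_ultrametric: "padic_abs (x + y :: 'p::prime_card padic) \<le> max (padic_abs x) (padic_abs y)"
proof transfer
  fix X Y :: "nat \<Rightarrow> rat"
  assume X: "padic_rel TYPE('p) X X" and Y: "padic_rel TYPE('p) Y Y"
  have "padic_rel TYPE('p) (\<lambda>n. X n + Y n) (\<lambda>n. X n + Y n)"
    using X Y by (auto simp: padic_rel_def intro: padic_Cauchy_add[OF prime_CARD])
  from LIMSEQ_le[OF padic_abs_lim[OF this] tendsto_max[OF padic_abs_lim[OF X] padic_abs_lim[OF Y]]]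
  show "lim (\<lambda>n. rat_padic_abs CARD('p) (X n + Y n)) \<le>
      max (lim (\<lambda>n. rat_padic_abs CARD('p) (X n))) (lim (\<lambda>n. rat_padic_abs CARD('p) (Y n)))"
    using rat_padic_abs_ultrametric[OF prime_CARD] by blast
qed

lemma padic_abs_nonneg: "0 \<le> padic_abs (x :: 'p::prime_card padic)"
proof transfer
  fix X :: "nat \<Rightarrow> rat"
  assume X: "padic_rel TYPE('p) X X"
  show "0 \<le> lim (\<lambda>n. rat_padic_abs CARD('p) (X n))"
    using LIMSEQ_le_const[OF padic_abs_lim[OF X]] by auto
qed

lemma padic_abs_of_rat:
  "padic_abs (padic_of_seq (\<lambda>n. x) :: 'p::prime_card padic) = rat_padic_abs CARD('p) x"
  by (subst padic_abs.abs_eq) (auto simp: padic_rel_def intro: limI)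

instantiation padic :: (prime_card) metric_space
begin

definition dist_padic :: "'a padic \<Rightarrow> 'a padic \<Rightarrow> real" where
  "dist_padic x y = padic_abs (x - y)"

definition uniformity_padic :: "('a padic \<times> 'a padic) filter" where
  "uniformity_padic = (INF e\<in>{0 <..}. principal {(x, y). dist x y < e})"

definition open_padic :: "'a padic set \<Rightarrow> bool" where
  "open_padic U \<longleftrightarrow> (\<forall>x\<in>U. eventually (\<lambda>(x', y). x' = x \<longrightarrow> y \<in> U) uniformity)"

instance
proof
  fix x y z :: "'a padic"
  show "(dist x y = 0) = (x = y)"
    by (simp add: dist_padic_def padic_abs_eq_0_iff)
  have "padic_abs (x - y) \<le> max (padic_abs (x - z)) (padic_abs (z - y))"
    using padic_abs_ultrametric[of "x - z" "z - y"] by simp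
  also have "\<dots> \<le> padic_abs (x - z) + padic_abs (y - z)"
    using padic_abs_nonneg[of "x - z"] padic_abs_nonneg[of "y - z"] padic_abs_minus[of "y - z"]
    by (simp add: max_def)
  finally show "dist x y \<le> dist x z + dist y z"
    by (simp add: dist_padic_def)
qed (simp_all add: uniformity_padic_def open_padic_def)

end

text \<open>
  On the second countable locally compact group of p-adic numbers these conditions determine the
  Borel measure \<open>M\<close> uniquely.
\<close>

definition normalized_haar :: "'p::prime_card padic measure \<Rightarrow> bool" where
  "normalized_haar M \<longleftrightarrow>
     sets M = sets borel \<and>
     (\<forall>a. \<forall>E\<in>sets borel. emeasure M ((+) a ` E) = emeasure M E) \<and>
     emeasure M {x. padic_abs x \<le> 1} = 1"

definition padic_ball :: "int \<Rightarrow> 'p::prime_card padic \<Rightarrow> 'p padic set" where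
  "padic_ball l a = {x. padic_abs (x - a) \<le> real CARD('p) powi l}"

definition locally_integrable ::
    "'p::prime_card padic measure \<Rightarrow> ('p padic \<Rightarrow> complex) \<Rightarrow> bool" where
  "locally_integrable M f \<longleftrightarrow>
     f \<in> borel_measurable M \<and> (\<forall>K. compact K \<longrightarrow> set_integrable M K f)"

text \<open>Powers of extended nonnegative reals, used only for exponents \<open>s > 0\<close>.\<close>

definition ennreal_powr :: "ennreal \<Rightarrow> real \<Rightarrow> ennreal" where
  "ennreal_powr x s = (if x = \<infinity> then \<infinity> else ennreal (enn2real x powr s))"

text \<open>At \<open>x = 0\<close> the factor in front of the integral is \<open>1 / 0 = 0\<close>; a single point is a null set.\<close>

definition cesaro_mean ::
    "'p::prime_card padic measure \<Rightarrow> real \<Rightarrow> ('p padic \<Rightarrow> complex) \<Rightarrow> 'p padic \<Rightarrow> ennreal" where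
  "cesaro_mean M \<beta> f x =
     ennreal (1 / padic_abs x powr (1 - \<beta>)) *
     (\<integral>\<^sup>+t\<in>{t. padic_abs t \<le> padic_abs x}. ennreal (norm (f t)) \<partial>M)"

definition cesaro_morrey_norm ::
    "'p::prime_card padic measure \<Rightarrow> real \<Rightarrow> real \<Rightarrow> real \<Rightarrow> ('p padic \<Rightarrow> complex) \<Rightarrow> ennreal" where
  "cesaro_morrey_norm M \<beta> r q f =
     (SUP (a, l) \<in> UNIV.
        ennreal (measure M (padic_ball l a) powr (1 / q - 1 / r)) *
        ennreal_powr (\<integral>\<^sup>+x\<in>padic_ball l a. ennreal_powr (cesaro_mean M \<beta> f x) r \<partial>M) (1 / r))"

definition cesaro_morrey_space ::
    "'p::prime_card padic measure \<Rightarrow> real \<Rightarrow> real \<Rightarrow> real \<Rightarrow> ('p padic \<Rightarrow> complex) set" where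
  "cesaro_morrey_space M \<beta> r q =
     {f. locally_integrable M f \<and> cesaro_morrey_norm M \<beta> r q f < \<infinity>}"

definition hilbert_kernel_integrand ::
    "('p::prime_card padic \<Rightarrow> complex) \<Rightarrow> 'p padic \<Rightarrow> 'p padic \<Rightarrow> complex" where
  "hilbert_kernel_integrand f t s = f s / of_real (padic_abs s + padic_abs t)"

definition padic_hilbert ::
    "'p::prime_card padic measure \<Rightarrow> ('p padic \<Rightarrow> complex) \<Rightarrow> 'p padic \<Rightarrow> complex" where
  "padic_hilbert M f t = (LINT s:{s. s \<noteq> 0}|M. hilbert_kernel_integrand f t s)"

definition hilbert_const_term :: "nat \<Rightarrow> real \<Rightarrow> real \<Rightarrow> int \<Rightarrow> real" where
  "hilbert_const_term p \<beta> q j =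
     real p powr (real_of_int j * (1 - \<beta> - 1 / q)) / (1 + real p powi j)"

definition hilbert_const :: "nat \<Rightarrow> real \<Rightarrow> real \<Rightarrow> real" where
  "hilbert_const p \<beta> q = (1 - 1 / real p) * (\<Sum>\<^sub>\<infinity>j\<in>UNIV. hilbert_const_term p \<beta> q j)"

end

theory Submission
  imports Defs
begin

text \<open>
  The Hilbert transform and the Cesaro mean of any function depend on the absolute value only.
  Write \<open>S_k\<close> for the sphere \<open>|x| = p^k\<close> and \<open>\<phi> n\<close> for
  the constant value of the fractional Cesaro mean of \<open>f\<close> on \<open>S_n\<close> (\<open>cesaro_profile\<close>), that is,
  \<open>p^(-n(1-\<beta>))\<close> times the mass of \<open>f\<close> on the ball \<open>|t| \<le> p^n\<close>.  Since \<open>1 / (|s| + |t|)\<close> is constant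
  on products of spheres, and the measure \<open>p^k (1 - 1/p)\<close> of \<open>S_k\<close> cancels the homogeneity of the
  kernel, decomposing both integrals into spheres and interchanging sums bounds the Cesaro mean of
  \<open>\<H> f\<close> by a superposition of dilates of the Cesaro mean of \<open>f\<close>
  (\<open>cesaro_profile_hilbert_le\<close>):

  \<open>C(\<H> f) n \<le> \<Sum>j. d j * \<phi> (n + j)\<close> with \<open>d j = (1 - 1/p) p^(j(1-\<beta>)) / (1 + p^j)\<close>.

  Dilation by \<open>p^j\<close> permutes the balls, mapping \<open>B^l(a)\<close> to some \<open>B^(l+j)(c)\<close>, and scales Haar measure
  by \<open>p^j\<close> (\<open>emeasure_ball_sphere_dilate\<close>).  Taking into account the normalizing factor of the Morrey
  norm, each dilate has norm at most \<open>p^(-j/q)\<close> times that of \<open>\<phi>\<close>.  Minkowski's inequality in \<open>L^r\<close> on each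
  ball (\<open>Minkowski_countable_sum\<close>) now gives the norm bound with the constant
  \<open>\<Sum>j. d j * p^(-j/q)\<close>, and this is \<open>hilbert_const\<close>.

  Convergence is settled by the same series.  It is finite because its terms decay geometrically
  in both directions, and a ball of radius \<open>p^(n-1)\<close> inside \<open>S_n\<close> shows \<open>\<phi> n \<le> const * p^(-n/q)\<close>
  (\<open>cesaro_profile_le\<close>), so that the superposition of dilates is finite and the integral defining
  \<open>\<H> f\<close> converges absolutely.

  The ingredients about p-adic numbers are that nonzero absolute values are integral powers of
  \<open>p\<close> and that the residue field has \<open>p\<close> elements; they yield the measure \<open>p^l\<close> of a ball of radius
  \<open>p^l\<close> from translation invariance and the normalization alone.
\<close>

section \<open>The value group and the residue field\<close>

abbreviation padic_of_rat :: "rat \<Rightarrow> 'p::prime_card padic" where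
  "padic_of_rat c \<equiv> padic_of_seq (\<lambda>_. c)"

lemma padic_of_rat_diff:
  "(padic_of_rat a - padic_of_rat b :: 'p::prime_card padic) = padic_of_rat (a - b)"
  unfolding minus_padic_def
  by (simp add: uminus_padic.abs_eq plus_padic.abs_eq padic_rel_def)

lemma padic_abs_diff_commute:
  "padic_abs (x - y :: 'p::prime_card padic) = padic_abs (y - x)"
  using padic_abs_minus[of "y - x"] by simp

lemma padic_abs_diff_le_max:
  "padic_abs (x - y :: 'p::prime_card padic) \<le> max (padic_abs x) (padic_abs y)"
  using padic_abs_ultrametric[of x "- y"] by (simp add: padic_abs_minus)

lemma padic_abs_eq_of_near:
  assumes "padic_abs (x - y :: 'p::prime_card padic) < padic_abs x"
  shows "padic_abs y = padic_abs x"
  using padic_abs_ultrametric[of "x - y" y] padic_abs_diff_le_max[of x "x - y"] assms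
  by (simp add: max_def split: if_splits)

text \<open>
  A Cauchy sequence of rationals converges to the element that it represents, so a late term of the
  sequence is the required approximation.
\<close>

lemma padic_rat_dense:
  fixes x :: "'p::prime_card padic"
  assumes "e > 0"
  shows "\<exists>c. padic_abs (x - padic_of_rat c) < e"
proof -
  obtain X where X: "padic_rel TYPE('p) X X" and x: "padic_of_seq X = x"
    using that[of "padic_rep x"] Quotient_rep_reflp[OF Quotient_padic] Quotient_abs_rep[OF Quotient_padic]
    by auto
  obtain N where N: "\<forall>m\<ge>N. \<forall>n\<ge>N. rat_padic_abs CARD('p) (X m - X n) < e/2"
    using X assms unfolding padic_rel_def padic_Cauchy_def by (meson half_gt_zero)
  have rel: "padic_rel TYPE('p) (\<lambda>n. X n - X N) (\<lambda>n. X n - X N)"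
    using padic_Cauchy_add[OF prime_CARD, of X "\<lambda>_. - X N"] X by (simp add: padic_rel_def)
  have "x - padic_of_rat (X N) = padic_of_seq (\<lambda>n. X n - X N)"
    unfolding minus_padic_def x[symmetric]
    by (subst uminus_padic.abs_eq) (use X in \<open>auto simp: padic_rel_def plus_padic.abs_eq\<close>)
  then have "padic_abs (x - padic_of_rat (X N)) = lim (\<lambda>n. rat_padic_abs CARD('p) (X n - X N))"
    using rel by (simp add: padic_abs.abs_eq)
  also have "\<dots> \<le> e/2"
    by (rule LIMSEQ_le_const2[OF padic_abs_lim[OF rel]], intro exI[of _ N] allI impI less_imp_le)
      (use N in simp)
  finally show ?thesis using assms by (intro exI[of _ "X N"]) simp
qed

lemma CARD_gt_1: "real CARD('p::prime_card) > 1"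
  using prime_gt_1_nat[OF prime_CARD[where 'p='p]] by simp

text \<open>
  Ultrametric absolute values are locally constant away from zero, so a sufficiently close rational
  has the same absolute value, and for rationals it is a power of \<open>p\<close> by definition.
\<close>

lemma padic_abs_value:
  assumes "x \<noteq> (0 :: 'p::prime_card padic)"
  shows "\<exists>k::int. padic_abs x = real CARD('p) powi k"
proof -
  have "padic_abs x > 0"
    using padic_abs_nonneg[of x] padic_abs_eq_0_iff[of x] assms by linarith
  then obtain c where c: "padic_abs (x - padic_of_rat c) < padic_abs x"
    using padic_rat_dense by blast
  have *: "rat_padic_abs CARD('p) c = padic_abs x"
    using padic_abs_eq_of_near[OF c] by (simp add: padic_abs_of_rat)
  then have "c \<noteq> 0" using \<open>padic_abs x > 0\<close> by auto
  then show ?thesis using *[symmetric] unfolding rat_padic_abs_def by auto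
qed

lemma padic_abs_of_value_exists:
  "\<exists>x :: 'p::prime_card padic. x \<noteq> 0 \<and> padic_abs x = real CARD('p) powi k"
proof -
  define c :: rat where "c = (if k \<le> 0 then of_int (int CARD('p) ^ nat (- k)) / of_int 1
                                   else of_int 1 / of_int (int CARD('p) ^ nat k))"
  have nz: "int CARD('p) ^ n \<noteq> 0" for n using prime_gt_0_nat[OF prime_CARD[where 'p='p]] by simp
  have m: "multiplicity (int CARD('p)) (int CARD('p) ^ n) = n" for n
    using CARD_gt_1[where 'p='p] by (intro multiplicity_same_power) auto
  have "rat_padic_abs CARD('p) c = real CARD('p) powi k"
    unfolding c_def using rat_padic_abs_frac[OF prime_CARD[where 'p='p] nz, of 1]
      rat_padic_abs_frac[OF prime_CARD[where 'p='p] _ nz, of 1] m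
    by (simp add: power_int_def del: of_int_power)
  then have 1: "padic_abs (padic_of_rat c :: 'p padic) = real CARD('p) powi k"
    by (simp add: padic_abs_of_rat)
  moreover have "padic_of_rat c \<noteq> (0 :: 'p padic)"
    using 1 CARD_gt_1[where 'p='p] padic_abs_eq_0_iff[of "padic_of_rat c :: 'p padic"] by auto
  ultimately show ?thesis by blast
qed

text \<open>
  Discreteness of the value group: an open ball of radius \<open>p^(k+1)\<close> is the closed ball of
  radius \<open>p^k\<close>.
\<close>

lemma padic_abs_less_imp_le:
  assumes "padic_abs (x :: 'p::prime_card padic) < real CARD('p) powi (k + 1)"
  shows "padic_abs x \<le> real CARD('p) powi k"
proof (cases "x = 0")
  case False
  then obtain j where j: "padic_abs x = real CARD('p) powi j" using padic_abs_value by blast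
  have "j < k + 1"
    using assms CARD_gt_1[where 'p='p] power_int_increasing[of "k+1" j "real CARD('p)"]
    unfolding j by linarith
  then show ?thesis
    using power_int_increasing[of j k "real CARD('p)"] CARD_gt_1[where 'p='p] unfolding j by simp
next
  case True then show ?thesis using padic_abs_eq_0_iff[of x] by simp
qed

text \<open>
  Write \<open>c = a / b\<close> in lowest terms.  Integrality of \<open>c\<close> makes \<open>b\<close> prime to \<open>p\<close>, hence
  invertible modulo \<open>p\<close>, and the residue of \<open>c\<close> is \<open>a * b^(-1) mod p\<close>.
\<close>

lemma rat_padic_residue:
  assumes p: "prime p" and c: "rat_padic_abs p c \<le> 1"
  shows "\<exists>i<p. rat_padic_abs p (c - of_nat i) < 1"
proof (cases "c = 0")
  case True then show ?thesis using prime_gt_0_nat[OF p] by (intro exI[of _ 0]) auto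
next
  case False
  obtain a b where q: "quotient_of c = (a, b)" by (metis surj_pair)
  have b: "b > 0" and cop: "coprime a b" and ceq: "c = of_int a / of_int b"
    using quotient_of_denom_pos[OF q] quotient_of_coprime[OF q] quotient_of_div[OF q] by auto
  have a: "a \<noteq> 0" using ceq False by auto
  have p1: "real p > 1" using prime_gt_1_nat[OF p] by simp
  have pi: "prime (int p)" using p by simp
  have nd: "\<not> int p dvd b"
  proof
    assume "int p dvd b"
    then have "\<not> int p dvd a" using cop pi by (meson coprime_common_divisor not_prime_unit)
    then have "multiplicity (int p) a = 0" by (rule not_dvd_imp_multiplicity_0)
    moreover have "multiplicity (int p) b > 0" using \<open>int p dvd b\<close> b p
      by (subst multiplicity_gt_zero_iff) auto
    ultimately have "rat_padic_abs p c > 1"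
      unfolding ceq using p1 a b
      by (subst rat_padic_abs_frac[OF p]) (simp_all add: one_less_power)
    with c show False by simp
  qed
  have mb: "multiplicity (int p) b = 0" using nd by (rule not_dvd_imp_multiplicity_0)
  have "coprime b (int p)"
    using prime_imp_coprime[OF pi nd] by (simp add: coprime_commute)
  then obtain y where y: "[b * y = 1] (mod int p)" using cong_solve_coprime_int by blast
  define i where "i = nat ((a * y) mod int p)"
  have i: "int i = (a * y) mod int p" "i < p"
    using p1 unfolding i_def by (auto simp: nat_less_iff)
  have "[b * int i = b * (a * y)] (mod int p)"
    unfolding i by (simp add: cong_def mod_mult_right_eq)
  also have "b * (a * y) = a * (b * y)" by simp
  also have "[\<dots> = a * 1] (mod int p)" using y by (rule cong_mult[OF cong_refl])
  finally have dv: "int p dvd a - b * int i" by (simp add: cong_iff_dvd_diff dvd_diff_commute)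
  have eq: "c - of_nat i = of_int (a - b * int i) / of_int b"
    unfolding ceq using b by (simp add: field_simps)
  have "rat_padic_abs p (c - of_nat i) < 1"
  proof (cases "a - b * int i = 0")
    case True then show ?thesis unfolding eq by (simp only:) simp
  next
    case False
    have "multiplicity (int p) (a - b * int i) > 0"
      using False dv p by (subst multiplicity_gt_zero_iff) auto
    then show ?thesis unfolding eq using False b mb p1
      by (subst rat_padic_abs_frac[OF p]) (simp_all add: power_int_minus inverse_less_1_iff one_less_power)
  qed
  then show ?thesis using i by blast
qed

text \<open>
  The residue field of the p-adic integers has at most \<open>p\<close> elements; together with
  \<open>padic_residues_distinct\<close> it has exactly \<open>p\<close>, which is what fixes the growth rate of the
  Haar measure of balls.
\<close>

lemma padic_residue:
  assumes "padic_abs (x :: 'p::prime_card padic) \<le> 1"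
  shows "\<exists>i<CARD('p). padic_abs (x - padic_of_rat (of_nat i)) < 1"
proof -
  obtain c where c: "padic_abs (x - padic_of_rat c) < 1"
    using padic_rat_dense[of 1 x] by auto
  have "padic_abs (padic_of_rat c :: 'p padic) \<le> 1"
    using padic_abs_diff_le_max[of x "x - padic_of_rat c"] assms c by simp
  then obtain i where i: "i < CARD('p)" "rat_padic_abs CARD('p) (c - of_nat i) < 1"
    using rat_padic_residue[OF prime_CARD[where 'p='p], of c] by (auto simp: padic_abs_of_rat)
  have "padic_abs (padic_of_rat c - padic_of_rat (of_nat i) :: 'p padic) < 1"
    using i by (simp add: padic_of_rat_diff padic_abs_of_rat)
  then have "padic_abs (x - padic_of_rat (of_nat i)) < 1"
    using padic_abs_ultrametric[of "x - padic_of_rat c" "padic_of_rat c - padic_of_rat (of_nat i)"] c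
    by simp
  then show ?thesis using i by blast
qed

lemma padic_residues_distinct:
  assumes "i < CARD('p::prime_card)" "j < CARD('p)" "i \<noteq> j"
  shows "padic_abs (padic_of_rat (of_nat i) - padic_of_rat (of_nat j) :: 'p padic) = 1"
proof -
  have nd: "\<not> int CARD('p) dvd int i - int j"
    using assms dvd_imp_le_int[of "int i - int j" "int CARD('p)"] by auto
  then have "multiplicity (int CARD('p)) (int i - int j) = 0"
    by (rule not_dvd_imp_multiplicity_0)
  then show ?thesis
    using rat_padic_abs_frac[OF prime_CARD[where 'p='p], of "int i - int j" 1] assms(3)
    by (simp add: padic_of_rat_diff padic_abs_of_rat)
qed

section \<open>Haar measure of balls and spheres\<close>

definition padic_sphere :: "int \<Rightarrow> 'p::prime_card padic set" where
  "padic_sphere k = {x. padic_abs x = real CARD('p) powi k}"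

lemma powi_CARD_le_iff [simp]:
  "real CARD('p::prime_card) powi i \<le> real CARD('p) powi j \<longleftrightarrow> i \<le> j"
proof
  show "i \<le> j" if "real CARD('p) powi i \<le> real CARD('p) powi j"
  proof (rule ccontr)
    assume "\<not> i \<le> j"
    then have "real CARD('p) powi j < real CARD('p) powi i"
      using CARD_gt_1[where 'p='p] by (intro power_int_strict_increasing) auto
    with that show False by simp
  qed
  show "real CARD('p) powi i \<le> real CARD('p) powi j" if "i \<le> j"
    using that CARD_gt_1[where 'p='p] by (intro power_int_increasing) auto
qed

lemma powi_CARD_less_iff [simp]:
  "real CARD('p::prime_card) powi i < real CARD('p) powi j \<longleftrightarrow> i < j"
  using powi_CARD_le_iff[of j i, where 'p='p] by linarith

lemma powi_CARD_eq_iff [simp]: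
  "real CARD('p::prime_card) powi i = real CARD('p) powi j \<longleftrightarrow> i = j"
  by (metis order.antisym order.refl powi_CARD_le_iff)

lemma powi_CARD_pos [simp]: "real CARD('p::prime_card) powi i > 0"
  using CARD_gt_1[where 'p='p] by simp

lemma powi_CARD_add:
  "real CARD('p::prime_card) powi (i + j) = real CARD('p) powi i * real CARD('p) powi j"
  using CARD_gt_1[where 'p='p] by (simp add: power_int_add)

lemma padic_abs_zero [simp]: "padic_abs (0 :: 'p::prime_card padic) = 0"
  by (simp add: padic_abs_eq_0_iff)

lemma padic_nonzero_in_sphere: "x \<noteq> 0 \<Longrightarrow> \<exists>k. (x :: 'p::prime_card padic) \<in> padic_sphere k"
  using padic_abs_value by (auto simp: padic_sphere_def)

lemma padic_sphere_disjoint: "x \<in> padic_sphere k \<Longrightarrow> x \<in> padic_sphere j \<longleftrightarrow> j = k"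
  by (auto simp: padic_sphere_def)

lemma zero_notin_padic_sphere: "0 \<notin> padic_sphere k"
  by (simp add: padic_sphere_def)

lemma padic_sphere_eq_diff:
  "padic_sphere k = (padic_ball k 0 - padic_ball (k - 1) 0 :: 'p::prime_card padic set)"
proof -
  have "padic_abs x = real CARD('p) powi k" 
    if "padic_abs x \<le> real CARD('p) powi k" "\<not> padic_abs x \<le> real CARD('p) powi (k - 1)" for x :: "'p padic"
    using padic_abs_less_imp_le[of x "k - 1"] that by (cases "padic_abs x < real CARD('p) powi k") auto
  then show ?thesis by (auto simp: padic_sphere_def padic_ball_def)
qed

lemma padic_ball_closed: "closed (padic_ball l (a :: 'p::prime_card padic))"
proof -
  have "padic_ball l a = cball a (real CARD('p) powi l)"
    by (auto simp: padic_ball_def dist_padic_def padic_abs_diff_commute)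
  then show ?thesis by simp
qed

lemma padic_ball_translate: "padic_ball l a = (+) a ` padic_ball l (0 :: 'p::prime_card padic)"
proof (intro equalityI subsetI)
  fix x assume "x \<in> padic_ball l a"
  then have "x - a \<in> padic_ball l 0" by (simp add: padic_ball_def)
  then have "a + (x - a) \<in> (+) a ` padic_ball l 0" by (rule imageI)
  then show "x \<in> (+) a ` padic_ball l 0" by simp
qed (auto simp: padic_ball_def)

text \<open>
  The cosets of \<open>B^l(0)\<close> in \<open>B^(l+1)(0)\<close>: dividing by an element \<open>u\<close> of absolute value
  \<open>p^(l+1)\<close> turns them into the residue classes of the p-adic integers.
\<close>

lemma padic_ball_split:
  fixes u :: "'p::prime_card padic"
  assumes u: "padic_abs u = real CARD('p) powi (l + 1)"
  shows "padic_ball (l + 1) 0 = (\<Union>i<CARD('p). padic_ball l (u * padic_of_rat (of_nat i)))"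
    and "disjoint_family_on (\<lambda>i. padic_ball l (u * padic_of_rat (of_nat i))) {..<CARD('p)}"
proof -
  let ?r = "\<lambda>i. padic_of_rat (of_nat i) :: 'p padic"
  have u0: "u \<noteq> 0"
  proof
    assume "u = 0"
    then have "real CARD('p) powi (l + 1) = 0" using u by simp
    then show False using powi_CARD_pos[of "l + 1", where 'p='p] by linarith
  qed
  have r1: "padic_abs (?r i) \<le> 1" for i
  proof (cases "i = 0")
    case False
    have "multiplicity (int CARD('p)) 1 = 0" by simp
    then have "rat_padic_abs CARD('p) (of_nat i) = real CARD('p) powi (- int (multiplicity (int CARD('p)) (int i)))"
      using rat_padic_abs_frac[OF prime_CARD[where 'p='p], of "int i" 1] False by simp
    also have "\<dots> \<le> real CARD('p) powi 0" by (subst powi_CARD_le_iff) simp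
    finally show ?thesis by (simp add: padic_abs_of_rat)
  qed (simp add: padic_abs_of_rat)
  show "padic_ball (l + 1) 0 = (\<Union>i<CARD('p). padic_ball l (u * ?r i))"
  proof (intro equalityI subsetI)
    fix x assume x: "x \<in> padic_ball (l + 1) (0 :: 'p padic)"
    have xu: "padic_abs x = padic_abs (x / u) * padic_abs u"
      using u0 by (simp flip: padic_abs_mult)
    have "padic_abs (x / u) \<le> 1"
      using x xu u powi_CARD_pos[of "l + 1", where 'p='p] by (simp add: padic_ball_def mult_le_cancel_right1)
    then obtain i where i: "i < CARD('p)" "padic_abs (x / u - ?r i) < 1"
      using padic_residue by blast
    have "x - u * ?r i = (x / u - ?r i) * u" using u0 by (simp add: field_simps)
    then have "padic_abs (x - u * ?r i) = padic_abs (x / u - ?r i) * padic_abs u"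
      by (simp add: padic_abs_mult)
    also have "\<dots> < 1 * padic_abs u" unfolding u using i by (intro mult_strict_right_mono) auto
    finally have "padic_abs (x - u * ?r i) < real CARD('p) powi (l + 1)" using u by simp
    then show "x \<in> (\<Union>i<CARD('p). padic_ball l (u * ?r i))"
      using i padic_abs_less_imp_le unfolding padic_ball_def by blast
  next
    fix x assume "x \<in> (\<Union>i<CARD('p). padic_ball l (u * ?r i))"
    then obtain i where i: "padic_abs (x - u * ?r i) \<le> real CARD('p) powi l"
      by (auto simp: padic_ball_def)
    have "padic_abs (u * ?r i) \<le> real CARD('p) powi (l + 1)"
      unfolding padic_abs_mult u by (rule mult_left_le) (use r1 in auto)
    moreover have "real CARD('p) powi l \<le> real CARD('p) powi (l + 1)" by simp
    ultimately have "padic_abs (x - u * ?r i + u * ?r i) \<le> real CARD('p) powi (l + 1)"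
      using padic_abs_ultrametric[of "x - u * ?r i" "u * ?r i"] i by linarith
    then show "x \<in> padic_ball (l + 1) 0" by (simp add: padic_ball_def)
  qed
  show "disjoint_family_on (\<lambda>i. padic_ball l (u * ?r i)) {..<CARD('p)}"
    unfolding disjoint_family_on_def
  proof (intro ballI impI equals0I)
    fix i j x assume ij: "i \<in> {..<CARD('p)}" "j \<in> {..<CARD('p)}" "i \<noteq> j"
      and x: "x \<in> padic_ball l (u * ?r i) \<inter> padic_ball l (u * ?r j)"
    have "padic_abs (u * (?r i - ?r j)) = real CARD('p) powi (l + 1)"
      unfolding padic_abs_mult u using padic_residues_distinct[of i j] ij by simp
    moreover have "u * (?r i - ?r j) = (x - u * ?r j) - (x - u * ?r i)" by (simp add: algebra_simps)
    moreover have "padic_abs ((x - u * ?r j) - (x - u * ?r i)) \<le> real CARD('p) powi l"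
      using padic_abs_diff_le_max[of "x - u * ?r j" "x - u * ?r i"] x unfolding padic_ball_def
      by auto
    ultimately have "real CARD('p) powi (l + 1) \<le> real CARD('p) powi l" by metis
    then show False by simp
  qed
qed

lemma padic_abs_borel [measurable]: "padic_abs \<in> borel_measurable (borel :: 'p::prime_card padic measure)"
proof -
  have "continuous_on UNIV (\<lambda>x :: 'p padic. dist x 0)" by (intro continuous_intros)
  then show ?thesis
    by (intro borel_measurable_continuous_onI) (simp add: dist_padic_def)
qed

text \<open>
  A function of the absolute value is measurable whatever \<open>g\<close> is, because the absolute value takes
  only countably many values.  This covers the Cesaro mean and the Hilbert transform of an arbitrary
  function, both of which are radial.
\<close>

lemma radial_borel_measurable:
  fixes g :: "real \<Rightarrow> 'b::topological_space"
  shows "(\<lambda>x. g (padic_abs x)) \<in> borel_measurable (borel :: 'p::prime_card padic measure)"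
proof -
  define I where "I = insert 0 (range (\<lambda>k::int. real CARD('p) powi k))"
  have I: "countable I" by (simp add: I_def)
  have "padic_abs x \<in> I" for x :: "'p padic"
    using padic_abs_value[of x] by (cases "x = 0") (auto simp: I_def)
  moreover have "(padic_abs :: 'p padic \<Rightarrow> real) -` {a} \<in> sets borel" for a
    using measurable_sets[OF padic_abs_borel[where 'p='p], of "{a}"] by simp
  ultimately have "(padic_abs :: 'p padic \<Rightarrow> real) \<in> measurable borel (count_space I)"
    by (subst measurable_count_space_eq_countable[OF I]) auto
  then show ?thesis by (rule measurable_compose) simp
qed

context
  fixes M :: "'p::prime_card padic measure"
  assumes haar: "normalized_haar M"
begin

lemma haar_sets [measurable_cong]: "sets M = sets borel"
  using haar by (simp add: normalized_haar_def)

lemma padic_ball_sets [measurable]: "padic_ball l a \<in> sets M"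
  unfolding haar_sets using padic_ball_closed by (rule borel_closed)

lemma padic_sphere_sets [measurable]: "padic_sphere k \<in> sets M"
  unfolding padic_sphere_eq_diff by measurable

lemma emeasure_padic_ball_translate: "emeasure M (padic_ball l a) = emeasure M (padic_ball l 0)"
  using haar padic_ball_sets[unfolded haar_sets] unfolding padic_ball_translate[of l a] normalized_haar_def
  by blast

text \<open>
  \<open>B^(l+1)(0)\<close> is a disjoint union of \<open>p\<close> translates of \<open>B^l(0)\<close>.
\<close>

lemma emeasure_padic_ball_Suc:
  "emeasure M (padic_ball (l + 1) 0) = ennreal (real CARD('p)) * emeasure M (padic_ball l 0)"
proof -
  obtain u :: "'p padic" where u: "padic_abs u = real CARD('p) powi (l + 1)"
    using padic_abs_of_value_exists by blast
  have "emeasure M (padic_ball (l + 1) 0) = (\<Sum>i<CARD('p). emeasure M (padic_ball l (u * padic_of_rat (of_nat i))))"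
    unfolding padic_ball_split(1)[OF u]
    by (rule sum_emeasure[symmetric]) (use padic_ball_split(2)[OF u] in auto)
  then show ?thesis
    by (subst (asm) emeasure_padic_ball_translate) (simp add: ennreal_of_nat_eq_real_of_nat)
qed

lemma emeasure_padic_ball: "emeasure M (padic_ball l a) = ennreal (real CARD('p) powi l)"
proof -
  have "emeasure M (padic_ball l 0) = ennreal (real CARD('p) powi l)"
  proof (induction l rule: int_induct[where k=0])
    \<comment> \<open>The normalization of the Haar measure is exactly the case \<open>l = 0\<close>.\<close>
    case base
    show ?case using haar by (simp add: padic_ball_def normalized_haar_def)
  next
    case (step1 i)
    then show ?case
      by (simp add: emeasure_padic_ball_Suc powi_CARD_add ennreal_mult' mult.commute)
  next
    case (step2 i)
    have "ennreal (real CARD('p)) * emeasure M (padic_ball (i - 1) 0) = ennreal (real CARD('p) powi (i - 1 + 1))"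
      using step2.IH emeasure_padic_ball_Suc[of "i - 1"] by simp
    also have "\<dots> = ennreal (real CARD('p)) * ennreal (real CARD('p) powi (i - 1))"
      unfolding powi_CARD_add by (simp add: ennreal_mult' mult.commute)
    finally show ?case using CARD_gt_1[where 'p='p] by (simp add: ennreal_mult_cancel_left)
  qed
  then show ?thesis by (subst emeasure_padic_ball_translate)
qed

lemma emeasure_padic_sphere:
  "emeasure M (padic_sphere k) = ennreal (real CARD('p) powi k * (1 - 1 / real CARD('p)))"
proof -
  have "emeasure M (padic_sphere k) = ennreal (real CARD('p) powi k) - ennreal (real CARD('p) powi (k - 1))"
    unfolding padic_sphere_eq_diff
  proof (subst emeasure_Diff)
    have "real CARD('p) powi (k - 1) \<le> real CARD('p) powi k" by simp
    then show "padic_ball (k - 1) 0 \<subseteq> (padic_ball k 0 :: 'p padic set)"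
      unfolding padic_ball_def by (auto intro: order_trans)
  qed (simp_all add: emeasure_padic_ball)
  also have "real CARD('p) powi (k - 1) = real CARD('p) powi k / real CARD('p)"
    using CARD_gt_1[where 'p='p] by (simp add: power_int_diff)
  finally show ?thesis by (simp add: ennreal_minus algebra_simps)
qed

lemma emeasure_padic_zero: "emeasure M {0} = 0"
proof -
  have le: "emeasure M {0} \<le> ennreal (inverse (real CARD('p)) ^ n)" for n
  proof -
    have "emeasure M {0} \<le> emeasure M (padic_ball (- int n) 0)"
      by (intro emeasure_mono) (auto simp: padic_ball_def less_imp_le)
    then show ?thesis by (simp add: emeasure_padic_ball power_int_minus power_inverse)
  qed
  have "(\<lambda>n. ennreal (inverse (real CARD('p)) ^ n)) \<longlonglongrightarrow> ennreal 0"
    using CARD_gt_1[where 'p='p]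
    by (intro tendsto_ennrealI LIMSEQ_power_zero) (auto simp: inverse_less_1_iff)
  then have "emeasure M {0} \<le> ennreal 0"
    by (rule LIMSEQ_le_const) (use le in auto)
  then show ?thesis by simp
qed

lemma AE_padic_nonzero: "AE x in M. x \<noteq> 0"
  by (rule AE_I[of _ _ "{0}"]) (auto simp: emeasure_padic_zero haar_sets)

text \<open>
  The spheres partition the nonzero elements, and zero is a null point.  Sums over spheres are
  written as integrals over the counting measure on the integers, so that interchanging
  them with each other and with integrals over \<open>M\<close> needs no convergence argument.
\<close>

lemma nn_integral_padic_spheres:
  assumes [measurable]: "h \<in> borel_measurable M"
  shows "(\<integral>\<^sup>+x. h x \<partial>M) = (\<integral>\<^sup>+k. (\<integral>\<^sup>+x\<in>padic_sphere k. h x \<partial>M) \<partial>count_space UNIV)"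
proof -
  have "(\<integral>\<^sup>+x. h x \<partial>M) = (\<integral>\<^sup>+x. (\<integral>\<^sup>+k. h x * indicator (padic_sphere k) x \<partial>count_space UNIV) \<partial>M)"
  proof (rule nn_integral_cong_AE, use AE_padic_nonzero in eventually_elim)
    fix x :: "'p padic" assume "x \<noteq> 0"
    then obtain j where j: "x \<in> padic_sphere j" using padic_nonzero_in_sphere by blast
    have "(\<integral>\<^sup>+k. h x * indicator (padic_sphere k) x \<partial>count_space UNIV)
        = (\<integral>\<^sup>+k. h x * indicator {j} k \<partial>count_space UNIV)"
      using padic_sphere_disjoint[OF j] by (intro nn_integral_cong) (auto simp: indicator_def)
    then show "h x = (\<integral>\<^sup>+k. h x * indicator (padic_sphere k) x \<partial>count_space UNIV)"
      by (simp add: nn_integral_cmult_indicator)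
  qed
  also have "\<dots> = (\<integral>\<^sup>+k. (\<integral>\<^sup>+x\<in>padic_sphere k. h x \<partial>M) \<partial>count_space UNIV)"
    by (rule nn_integral_count_space_nn_integral) auto
  finally show ?thesis .
qed

lemma nn_integral_radial:
  assumes [measurable]: "h \<in> borel_measurable M" "A \<in> sets M"
    and H: "\<And>k x. x \<in> padic_sphere k \<Longrightarrow> h x = H k"
  shows "(\<integral>\<^sup>+x\<in>A. h x \<partial>M) = (\<integral>\<^sup>+k. H k * emeasure M (A \<inter> padic_sphere k) \<partial>count_space UNIV)"
proof -
  have "(\<integral>\<^sup>+x\<in>padic_sphere k. h x * indicator A x \<partial>M) = H k * emeasure M (A \<inter> padic_sphere k)" for k
  proof -
    have "(\<integral>\<^sup>+x\<in>padic_sphere k. h x * indicator A x \<partial>M) = (\<integral>\<^sup>+x. H k * indicator (A \<inter> padic_sphere k) x \<partial>M)"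
      using H by (intro nn_integral_cong) (auto simp: indicator_def)
    then show ?thesis by (simp add: nn_integral_cmult_indicator)
  qed
  then show ?thesis by (subst nn_integral_padic_spheres) auto
qed

lemma emeasure_ball_sphere_centered:
  assumes "padic_abs a \<le> real CARD('p) powi l"
  shows "emeasure M (padic_ball l a \<inter> padic_sphere k) =
    (if k \<le> l then ennreal (real CARD('p) powi k * (1 - 1 / real CARD('p))) else 0)"
proof -
  have "padic_abs (x - a) \<le> real CARD('p) powi l \<longleftrightarrow> padic_abs x \<le> real CARD('p) powi l" for x :: "'p padic"
    using padic_abs_diff_le_max[of x a] padic_abs_ultrametric[of "x - a" a] assms
    unfolding diff_add_cancel by linarith
  then have a: "padic_ball l a = padic_ball l 0" by (simp add: padic_ball_def)
  have "padic_ball l 0 \<inter> padic_sphere k = (if k \<le> l then padic_sphere k else {} :: 'p padic set)"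
    by (auto simp: padic_ball_def padic_sphere_def)
  then show ?thesis unfolding a by (simp add: emeasure_padic_sphere)
qed

text \<open>
  A ball that misses zero lies inside a single sphere: there the absolute value is constant.
\<close>

lemma emeasure_ball_sphere_off_center:
  assumes a: "padic_abs a = real CARD('p) powi n" and n: "l < n"
  shows "emeasure M (padic_ball l a \<inter> padic_sphere k) =
    (if k = n then ennreal (real CARD('p) powi l) else 0)"
proof -
  have "padic_abs x = real CARD('p) powi n" if "padic_abs (x - a) \<le> real CARD('p) powi l" for x :: "'p padic"
  proof -
    have "padic_abs (a - x) < padic_abs a"
      using that n powi_CARD_less_iff[of l n, where 'p='p] unfolding a padic_abs_diff_commute[of a x]
      by linarith
    from padic_abs_eq_of_near[OF this] show ?thesis using a by simp
  qed
  then have "padic_ball l a \<subseteq> padic_sphere n"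
    unfolding padic_ball_def padic_sphere_def by blast
  then have "padic_ball l a \<inter> padic_sphere k = (if k = n then padic_ball l a else {})"
    using padic_sphere_disjoint by auto
  then show ?thesis by (simp add: emeasure_padic_ball)
qed

text \<open>
  Multiplication by an element of absolute value \<open>p^j\<close> scales Haar measure by \<open>p^j\<close>.  For radial
  integrands only the sets \<open>B^l(a) \<inter> S_k\<close> matter, and for these the scaling can be read off from the
  explicit measures; the change of variables formula for general functions is thus avoided.
\<close>

lemma emeasure_ball_sphere_dilate:
  assumes c: "padic_abs c = real CARD('p) powi j * padic_abs a"
  shows "emeasure M (padic_ball (l + j) c \<inter> padic_sphere (k + j)) =
    ennreal (real CARD('p) powi j) * emeasure M (padic_ball l a \<inter> padic_sphere k)"
proof (cases "padic_abs a \<le> real CARD('p) powi l")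
  case True
  have "padic_abs c \<le> real CARD('p) powi (l + j)"
    using mult_left_mono[OF True less_imp_le[OF powi_CARD_pos[of j, where 'p='p]]]
    unfolding c powi_CARD_add by (simp only: mult.commute)
  then show ?thesis
    by (simp only: emeasure_ball_sphere_centered[OF True] emeasure_ball_sphere_centered)
      (simp add: powi_CARD_add mult_ac flip: ennreal_mult')
next
  case False
  then have "a \<noteq> 0" by (auto simp: less_imp_le)
  then obtain n where n: "padic_abs a = real CARD('p) powi n" using padic_abs_value by blast
  then have "l < n" using False by simp
  moreover have "padic_abs c = real CARD('p) powi (n + j)" by (simp add: c n powi_CARD_add)
  ultimately show ?thesis
    by (simp add: emeasure_ball_sphere_off_center[OF n] emeasure_ball_sphere_off_center[of c "n + j"]
        powi_CARD_add ennreal_mult' mult.commute)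
qed

end

section \<open>Powers of extended reals and Minkowski's inequality\<close>

lemma ennreal_powr_ennreal: "x \<ge> 0 \<Longrightarrow> ennreal_powr (ennreal x) s = ennreal (x powr s)"
  by (simp add: ennreal_powr_def)

lemma ennreal_powr_mono: "0 < s \<Longrightarrow> x \<le> y \<Longrightarrow> ennreal_powr x s \<le> ennreal_powr y s"
  by (cases x; cases y) (auto simp: ennreal_powr_def top_unique powr_mono2)

lemma ennreal_powr_le_iff:
  assumes "s > 0" "K \<ge> 0"
  shows "ennreal_powr x s \<le> ennreal K \<longleftrightarrow> x \<le> ennreal (K powr (1 / s))"
proof (cases x)
  case (real y)
  have "y powr s \<le> K \<longleftrightarrow> y \<le> K powr (1 / s)"
  proof
    assume "y powr s \<le> K"
    then have "(y powr s) powr (1 / s) \<le> K powr (1 / s)"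
      using assms by (intro powr_mono2) auto
    then show "y \<le> K powr (1 / s)" using assms real by (simp add: powr_powr)
  next
    assume "y \<le> K powr (1 / s)"
    then have "y powr s \<le> (K powr (1 / s)) powr s"
      using assms real by (intro powr_mono2) auto
    then show "y powr s \<le> K" using assms by (simp add: powr_powr)
  qed
  then show ?thesis using real assms by (simp add: ennreal_powr_ennreal)
next
  case top
  then show ?thesis by (simp add: ennreal_powr_def top_unique)
qed

text \<open>
  The convex function \<open>x powr r\<close> lies above its tangent at \<open>u\<close>.  Obtained from Young's inequality, it
  holds at \<open>u = 0\<close> and \<open>x = 0\<close> as well, with \<open>0 powr r = 0\<close>.
\<close>

lemma powr_tangent_bound:
  fixes x u r :: real
  assumes "x \<ge> 0" "u \<ge> 0" "r \<ge> 1"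
  shows "r * u powr (r - 1) * x \<le> x powr r + (r - 1) * u powr r"
proof (cases "r = 1")
  case True
  then show ?thesis using assms by simp
next
  case False
  then have r: "r > 1" using assms by simp
  have "x * u powr (r - 1) \<le> x powr r / r + (u powr (r - 1)) powr (r / (r - 1)) / (r / (r - 1))"
    using r assms by (intro Youngs_inequality) (auto simp: field_simps)
  also have "(u powr (r - 1)) powr (r / (r - 1)) = u powr r" using r by (simp add: powr_powr)
  finally have "r * (x * u powr (r - 1)) \<le> r * (x powr r / r + u powr r / (r / (r - 1)))"
    using r by (intro mult_left_mono) auto
  also have "\<dots> = x powr r + (r - 1) * u powr r" using r by (simp add: distrib_left)
  finally show ?thesis by (simp add: mult_ac)
qed

text \<open>
  Jensen's inequality for \<open>x powr r\<close>: integrate the tangent bound at the mean \<open>u\<close> of \<open>x\<close>.  The right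
  hand side may be infinite; only the mean has to be finite.
\<close>

lemma weighted_power_mean:
  fixes c x :: "'i \<Rightarrow> real"
  assumes r: "r \<ge> 1" and [measurable]: "c \<in> borel_measurable N" "x \<in> borel_measurable N"
    and c: "\<And>j. c j \<ge> 0" and x: "\<And>j. x j \<ge> 0"
    and c1: "(\<integral>\<^sup>+j. ennreal (c j) \<partial>N) = 1"
    and u: "u \<ge> 0" "(\<integral>\<^sup>+j. ennreal (c j * x j) \<partial>N) = ennreal u"
  shows "ennreal (u powr r) \<le> (\<integral>\<^sup>+j. ennreal (c j * x j powr r) \<partial>N)"
proof -
  have uu: "u powr (r - 1) * u = u powr r"
    using u by (cases "u = 0") (auto simp: powr_diff)
  have "ennreal (u powr r) + ennreal ((r - 1) * u powr r) = ennreal (u powr r + (r - 1) * u powr r)"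
    using r by (intro ennreal_plus[symmetric]) auto
  also have "u powr r + (r - 1) * u powr r = r * u powr (r - 1) * u"
    unfolding mult.assoc uu by (simp add: algebra_simps)
  also have "ennreal (r * u powr (r - 1) * u) = ennreal (r * u powr (r - 1)) * ennreal u"
    using r u by (intro ennreal_mult) auto
  also have "\<dots> = (\<integral>\<^sup>+j. ennreal (r * u powr (r - 1)) * ennreal (c j * x j) \<partial>N)"
    by (subst nn_integral_cmult) (auto simp: u(2))
  also have "\<dots> \<le> (\<integral>\<^sup>+j. ennreal (c j * x j powr r) + ennreal ((r - 1) * u powr r) * ennreal (c j) \<partial>N)"
  proof (rule nn_integral_mono)
    fix j
    have "c j * (r * u powr (r - 1) * x j) \<le> c j * (x j powr r + (r - 1) * u powr r)"
      using powr_tangent_bound[OF x u(1) r] c by (intro mult_left_mono)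
    then have "ennreal (r * u powr (r - 1) * (c j * x j)) \<le> ennreal (c j * x j powr r + (r - 1) * u powr r * c j)"
      by (intro ennreal_leI) (simp add: algebra_simps)
    then show "ennreal (r * u powr (r - 1)) * ennreal (c j * x j)
        \<le> ennreal (c j * x j powr r) + ennreal ((r - 1) * u powr r) * ennreal (c j)"
      using r c x by (simp add: ennreal_mult'' flip: ennreal_mult'' ennreal_plus)
  qed
  also have "\<dots> = (\<integral>\<^sup>+j. ennreal (c j * x j powr r) \<partial>N) + ennreal ((r - 1) * u powr r)"
    by (simp add: nn_integral_add nn_integral_cmult c1)
  finally show ?thesis
    by (simp add: add.commute[of _ "ennreal ((r - 1) * u powr r)"] ennreal_add_left_cancel_le)
qed

text \<open>
  Minkowski's inequality \<open>\<parallel>\<Sum>j. d j * \<Phi> j\<parallel> \<le> \<Sum>j. d j * \<parallel>\<Phi> j\<parallel>\<close> in the form needed here, where \<open>b j\<close> times a common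
  factor bounds the \<open>L^r\<close> norm of \<open>\<Phi> j\<close>, and \<open>R\<close> is the \<open>r\<close>-th power of that factor.  Normalizing each \<open>\<Phi> j\<close> to
  \<open>\<Phi> j / b j\<close> and using the probability weights \<open>d j * b j / C\<close>, the sum becomes a mean, to which
  \<open>weighted_power_mean\<close> applies pointwise; integrating and interchanging sum and integral finishes.
\<close>

lemma Minkowski_countable_sum:
  fixes d b :: "'i::countable \<Rightarrow> real" and \<Phi> :: "'i \<Rightarrow> 'a \<Rightarrow> real"
  assumes r: "r \<ge> 1" and d: "\<And>j. d j \<ge> 0" and b: "\<And>j. b j > 0" and C: "C > 0"
    and dbC: "(\<integral>\<^sup>+j. ennreal (d j * b j) \<partial>count_space UNIV) = ennreal C"
    and \<Phi>: "\<And>j x. \<Phi> j x \<ge> 0" and [measurable]: "\<And>j. \<Phi> j \<in> borel_measurable N"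
    and S: "\<And>x. S x \<ge> 0" "\<And>x. (\<integral>\<^sup>+j. ennreal (d j * \<Phi> j x) \<partial>count_space UNIV) = ennreal (S x)"
    and le: "\<And>j. (\<integral>\<^sup>+x. ennreal (\<Phi> j x powr r) \<partial>N) \<le> ennreal (b j powr r) * R"
  shows "(\<integral>\<^sup>+x. ennreal (S x powr r) \<partial>N) \<le> ennreal (C powr r) * R"
proof -
  \<comment> \<open>The coefficient of \<open>\<Phi> j x powr r\<close> after undoing both normalizations.\<close>
  define e where "e j = C powr r * (d j * b j / C) / b j powr r" for j
  have e: "e j \<ge> 0" for j unfolding e_def using d b C by (simp add: less_imp_le)
  have pt: "ennreal (S x powr r) \<le> (\<integral>\<^sup>+j. ennreal (e j * \<Phi> j x powr r) \<partial>count_space UNIV)" for x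
  proof -
    have "ennreal ((S x / C) powr r) \<le>
        (\<integral>\<^sup>+j. ennreal (d j * b j / C * (\<Phi> j x / b j) powr r) \<partial>count_space UNIV)"
    proof (rule weighted_power_mean[OF r])
      have "(\<integral>\<^sup>+j. ennreal (d j * b j / C) \<partial>count_space UNIV)
          = (\<integral>\<^sup>+j. ennreal (1 / C) * ennreal (d j * b j) \<partial>count_space UNIV)"
        using C d b by (intro nn_integral_cong) (simp add: less_imp_le flip: ennreal_mult)
      also have "\<dots> = ennreal (1 / C) * ennreal C" by (subst nn_integral_cmult) (auto simp: dbC)
      finally show "(\<integral>\<^sup>+j. ennreal (d j * b j / C) \<partial>count_space UNIV) = 1"
        using C by (simp flip: ennreal_mult)
      have "(\<integral>\<^sup>+j. ennreal (d j * b j / C * (\<Phi> j x / b j)) \<partial>count_space UNIV)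
          = (\<integral>\<^sup>+j. ennreal (1 / C) * ennreal (d j * \<Phi> j x) \<partial>count_space UNIV)"
      proof (intro nn_integral_cong)
        fix j
        have "d j * b j / C * (\<Phi> j x / b j) = (1 / C) * (d j * \<Phi> j x)" using b[of j] by simp
        then show "ennreal (d j * b j / C * (\<Phi> j x / b j)) = ennreal (1 / C) * ennreal (d j * \<Phi> j x)"
          using C d \<Phi> by (subst ennreal_mult[symmetric]) auto
      qed
      also have "\<dots> = ennreal (1 / C) * ennreal (S x)" by (subst nn_integral_cmult) (auto simp: S)
      finally show "(\<integral>\<^sup>+j. ennreal (d j * b j / C * (\<Phi> j x / b j)) \<partial>count_space UNIV) = ennreal (S x / C)"
        using C S by (simp flip: ennreal_mult)
    qed (use C d b \<Phi> S in \<open>auto simp: less_imp_le\<close>)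
    then have "ennreal (C powr r) * ennreal ((S x / C) powr r) \<le> ennreal (C powr r) *
        (\<integral>\<^sup>+j. ennreal (d j * b j / C * (\<Phi> j x / b j) powr r) \<partial>count_space UNIV)"
      by (rule mult_left_mono) simp
    also have "\<dots> = (\<integral>\<^sup>+j. ennreal (C powr r) * ennreal (d j * b j / C * (\<Phi> j x / b j) powr r) \<partial>count_space UNIV)"
      by (subst nn_integral_cmult) auto
    also have "\<dots> = (\<integral>\<^sup>+j. ennreal (e j * \<Phi> j x powr r) \<partial>count_space UNIV)"
    proof (intro nn_integral_cong)
      fix j
      have "C powr r * (d j * b j / C * (\<Phi> j x / b j) powr r) = e j * \<Phi> j x powr r"
        using b[of j] \<Phi>[of j x] by (simp add: e_def powr_divide)
      then show "ennreal (C powr r) * ennreal (d j * b j / C * (\<Phi> j x / b j) powr r) = ennreal (e j * \<Phi> j x powr r)"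
        using C d b[of j] by (subst ennreal_mult[symmetric]) (auto simp: less_imp_le)
    qed
    also have "ennreal (C powr r) * ennreal ((S x / C) powr r) = ennreal (S x powr r)"
      using C S by (subst ennreal_mult[symmetric]) (auto simp: powr_divide)
    finally show ?thesis .
  qed
  have "(\<integral>\<^sup>+x. ennreal (S x powr r) \<partial>N) \<le> (\<integral>\<^sup>+x. (\<integral>\<^sup>+j. ennreal (e j * \<Phi> j x powr r) \<partial>count_space UNIV) \<partial>N)"
    by (intro nn_integral_mono pt)
  also have "\<dots> = (\<integral>\<^sup>+j. (\<integral>\<^sup>+x. ennreal (e j * \<Phi> j x powr r) \<partial>N) \<partial>count_space UNIV)"
    by (rule nn_integral_count_space_nn_integral) auto
  also have "\<dots> = (\<integral>\<^sup>+j. ennreal (e j) * (\<integral>\<^sup>+x. ennreal (\<Phi> j x powr r) \<partial>N) \<partial>count_space UNIV)"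
    by (intro nn_integral_cong) (simp add: ennreal_mult e nn_integral_cmult)
  also have "\<dots> \<le> (\<integral>\<^sup>+j. ennreal (e j) * (ennreal (b j powr r) * R) \<partial>count_space UNIV)"
    by (intro nn_integral_mono mult_left_mono le) auto
  also have "\<dots> = (\<integral>\<^sup>+j. ennreal (d j * b j) * (ennreal (C powr r / C) * R) \<partial>count_space UNIV)"
  proof (intro nn_integral_cong)
    fix j
    have "ennreal (e j) * ennreal (b j powr r) = ennreal (d j * b j) * ennreal (C powr r / C)"
      using e[of j] b[of j] d[of j] C
      by (subst (1 2) ennreal_mult[symmetric]) (auto simp: e_def less_imp_le)
    then show "ennreal (e j) * (ennreal (b j powr r) * R) = ennreal (d j * b j) * (ennreal (C powr r / C) * R)"
      by (simp add: mult.assoc[symmetric])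
  qed
  also have "\<dots> = ennreal C * (ennreal (C powr r / C) * R)"
    by (subst nn_integral_multc) (auto simp: dbC)
  also have "\<dots> = ennreal (C powr r) * R"
    using C by (simp add: mult.assoc[symmetric] flip: ennreal_mult)
  finally show ?thesis .
qed

section \<open>The constant\<close>

lemma summable_on_int_geometric:
  fixes q :: real
  assumes "0 \<le> q" "q < 1"
  shows "(\<lambda>j::int. q ^ nat \<bar>j\<bar>) summable_on UNIV"
proof -
  have geo: "(\<lambda>n. q ^ (n + m)) summable_on UNIV" for m
    using assms by (intro norm_summable_imp_summable_on) (simp add: power_add summable_mult2)
  have "(\<lambda>j::int. q ^ nat \<bar>j\<bar>) summable_on range int"
    by (subst summable_on_reindex) (use geo[of 0] in \<open>auto simp: o_def\<close>)
  moreover have "(\<lambda>j::int. q ^ nat \<bar>j\<bar>) summable_on range (\<lambda>n. - int n - 1)"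
    by (subst summable_on_reindex)
      (use geo[of 1] in \<open>auto simp: o_def inj_on_def nat_add_distrib abs_if\<close>)
  moreover have "range int \<inter> range (\<lambda>n. - int n - 1) = {}" by auto
  moreover have "range int \<union> range (\<lambda>n. - int n - 1) = UNIV"
  proof -
    have "j \<in> range int \<union> range (\<lambda>n. - int n - 1)" for j
      by (cases j) (auto simp: image_iff)
    then show ?thesis by blast
  qed
  ultimately show ?thesis using summable_on_Un_disjoint by metis
qed

lemma hilbert_const_term_nonneg: "hilbert_const_term p \<beta> q j \<ge> 0"
  by (simp add: hilbert_const_term_def)

text \<open>
  With \<open>\<theta> = 1 - \<beta> - 1/q\<close> the terms decay like \<open>p^(-j(1-\<theta>))\<close> at plus infinity and like \<open>p^(j\<theta>)\<close> at minus
  infinity, so both ends converge precisely because \<open>\<theta>\<close> lies strictly between 0 and 1.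
\<close>

lemma hilbert_const_term_summable:
  assumes p: "real p > 1" and \<theta>: "0 < 1 - \<beta> - 1 / q" "1 - \<beta> - 1 / q < 1"
  shows "hilbert_const_term p \<beta> q summable_on UNIV"
proof -
  define \<theta> where "\<theta> = 1 - \<beta> - 1 / q"
  define \<delta> where "\<delta> = min \<theta> (1 - \<theta>)"
  have \<delta>: "\<delta> > 0" "\<delta> \<le> \<theta>" "\<delta> \<le> 1 - \<theta>" using assms by (auto simp: \<delta>_def \<theta>_def)
  define a where "a = real p powr (- \<delta>)"
  have a: "0 \<le> a" "a < 1" unfolding a_def using p \<delta> by (auto simp: powr_less_one)
  have bound: "hilbert_const_term p \<beta> q j \<le> a ^ nat \<bar>j\<bar>" for j
  proof -
    have aj: "a ^ nat \<bar>j\<bar> = real p powr (- \<delta> * \<bar>real_of_int j\<bar>)"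
      unfolding a_def using p by (simp add: powr_powr flip: powr_realpow)
    have pj: "real p powi j = real p powr real_of_int j"
      using p by (simp add: powr_real_of_int')
    show ?thesis
    proof (cases "j \<ge> 0")
      case True
      have "hilbert_const_term p \<beta> q j \<le> real p powr (j * \<theta>) / real p powr j"
        unfolding hilbert_const_term_def \<theta>_def[symmetric] pj using p by (intro frac_le) auto
      also have "\<dots> = real p powr (- (1 - \<theta>) * j)"
        by (simp add: powr_diff[symmetric] algebra_simps)
      also have "\<dots> \<le> real p powr (- \<delta> * \<bar>real_of_int j\<bar>)"
      proof (rule powr_mono)
        have "- (1 - \<theta>) * real_of_int j \<le> - \<delta> * real_of_int j"
          using True \<delta> by (intro mult_right_mono) auto
        then show "- (1 - \<theta>) * real_of_int j \<le> - \<delta> * \<bar>real_of_int j\<bar>" using True by simp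
      qed (use p in simp)
      finally show ?thesis unfolding aj .
    next
      case False
      have "hilbert_const_term p \<beta> q j \<le> real p powr (j * \<theta>) / 1"
        unfolding hilbert_const_term_def \<theta>_def[symmetric] pj using p by (intro frac_le) auto
      also have "\<dots> \<le> real p powr (- \<delta> * \<bar>real_of_int j\<bar>)"
      proof -
        have "real_of_int j * \<theta> \<le> real_of_int j * \<delta>" using False \<delta> by (intro mult_left_mono_neg) auto
        then show ?thesis using p False by (simp add: mult.commute)
      qed
      finally show ?thesis unfolding aj .
    qed
  qed
  show ?thesis
    by (rule summable_on_comparison_test[OF summable_on_int_geometric[OF a]])
      (use bound hilbert_const_term_nonneg in auto)
qed

lemma nn_integral_count_space_infsum:
  fixes f :: "'a \<Rightarrow> real"
  assumes "f summable_on A" "\<And>x. f x \<ge> 0"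
  shows "(\<integral>\<^sup>+x. ennreal (f x) \<partial>count_space A) = ennreal (\<Sum>\<^sub>\<infinity>x\<in>A. f x)"
proof -
  have "Infinite_Set_Sum.abs_summable_on f A"
    using assms by (simp flip: abs_summable_equivalent)
  then show ?thesis
    using assms by (simp add: nn_integral_conv_infsetsum infsetsum_infsum)
qed

lemma nn_integral_hilbert_const:
  assumes p: "real p > 1" and \<theta>: "0 < 1 - \<beta> - 1 / q" "1 - \<beta> - 1 / q < 1"
  shows "(\<integral>\<^sup>+j. ennreal ((1 - 1 / real p) * hilbert_const_term p \<beta> q j) \<partial>count_space UNIV)
    = ennreal (hilbert_const p \<beta> q)"
  using p unfolding hilbert_const_def
  by (subst nn_integral_count_space_infsum)
    (auto simp: hilbert_const_term_nonneg infsum_cmult_right'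
      intro: summable_on_cmult_right hilbert_const_term_summable[OF assms])

lemma hilbert_const_pos:
  assumes p: "real p > 1" and \<theta>: "0 < 1 - \<beta> - 1 / q" "1 - \<beta> - 1 / q < 1"
  shows "hilbert_const p \<beta> q > 0"
proof -
  have "0 < hilbert_const_term p \<beta> q 0"
    using p by (simp add: hilbert_const_term_def)
  also have "\<dots> \<le> (\<Sum>\<^sub>\<infinity>j\<in>UNIV. hilbert_const_term p \<beta> q j)"
    using infsum_mono_neutral[OF _ hilbert_const_term_summable[OF assms],
        of "hilbert_const_term p \<beta> q" "{0}"]
    by (simp add: hilbert_const_term_nonneg)
  finally show ?thesis using p by (simp add: hilbert_const_def)
qed

section \<open>The Cesaro means as a sequence\<close>

text \<open>
  The Cesaro mean is constant on spheres; its profile at \<open>n\<close> is the value on the sphere of radius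
  \<open>p^n\<close>.
\<close>

definition cesaro_profile ::
    "'p::prime_card padic measure \<Rightarrow> real \<Rightarrow> ('p padic \<Rightarrow> complex) \<Rightarrow> int \<Rightarrow> ennreal" where
  "cesaro_profile M \<beta> f n =
     ennreal (real CARD('p) powr (- (real_of_int n * (1 - \<beta>)))) *
     (\<integral>\<^sup>+t\<in>padic_ball n 0. ennreal (norm (f t)) \<partial>M)"

lemma powi_CARD_powr: "real CARD('p::prime_card) powi n = real CARD('p) powr real_of_int n"
  using CARD_gt_1[where 'p='p] by (simp add: powr_real_of_int')

lemma cesaro_mean_on_sphere:
  fixes x :: "'p::prime_card padic"
  assumes "x \<in> padic_sphere n"
  shows "cesaro_mean M \<beta> f x = cesaro_profile M \<beta> f n"
proof -
  have x: "padic_abs x = real CARD('p) powr real_of_int n"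
    using assms by (simp add: padic_sphere_def powi_CARD_powr)
  have "1 / padic_abs x powr (1 - \<beta>) = real CARD('p) powr (- (real_of_int n * (1 - \<beta>)))"
    unfolding x by (simp add: powr_powr powr_minus_divide)
  moreover have "{t. padic_abs t \<le> padic_abs x} = padic_ball n (0 :: 'p padic)"
    using assms by (simp add: padic_ball_def padic_sphere_def)
  ultimately show ?thesis unfolding cesaro_mean_def cesaro_profile_def by simp
qed

lemma ennreal_mult_le_iff_le_divide:
  assumes "c > 0" "K \<ge> 0"
  shows "ennreal c * Y \<le> ennreal K \<longleftrightarrow> Y \<le> ennreal (K / c)"
proof -
  have "ennreal K = ennreal c * ennreal (K / c)"
    using assms by (simp flip: ennreal_mult)
  then show ?thesis using assms by (simp add: ennreal_mult_le_mult_iff)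
qed

lemma nn_integral_int_shift:
  "(\<integral>\<^sup>+i. F (i + j) \<partial>count_space (UNIV :: int set)) = (\<integral>\<^sup>+i. F i \<partial>count_space UNIV)"
  by (rule nn_integral_bij_count_space, rule bij_betwI[of _ _ _ "\<lambda>i. i - j"]) auto

text \<open>
  The weight of the dilate by \<open>p^j\<close> when the Cesaro mean of the Hilbert transform is dominated by a
  superposition of dilates of the Cesaro mean of the function.
\<close>

definition dilation_weight :: "nat \<Rightarrow> real \<Rightarrow> int \<Rightarrow> real" where
  "dilation_weight p \<beta> j = (1 - 1 / real p) * real p powr (real_of_int j * (1 - \<beta>)) / (1 + real p powi j)"

lemma dilation_weight_nonneg: "p > 0 \<Longrightarrow> dilation_weight p \<beta> j \<ge> 0"
  unfolding dilation_weight_def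
  by (intro divide_nonneg_nonneg mult_nonneg_nonneg add_nonneg_nonneg) auto

text \<open>
  Dilating by \<open>p^j\<close> multiplies the Morrey norm by \<open>p^(-j/q)\<close>, and this factor turns the weights into the
  terms of the constant.
\<close>

lemma dilation_weight_hilbert_const:
  "dilation_weight p \<beta> j * real p powr (- real_of_int j / q)
    = (1 - 1 / real p) * hilbert_const_term p \<beta> q j"
proof -
  have "real p powr (real_of_int j * (1 - \<beta> - 1 / q))
      = real p powr (real_of_int j * (1 - \<beta>)) * real p powr (- real_of_int j / q)"
    by (simp add: powr_add[symmetric] algebra_simps)
  then show ?thesis by (simp add: dilation_weight_def hilbert_const_term_def)
qed

context
  fixes M :: "'p::prime_card padic measure"
  assumes haar: "normalized_haar M"
begin

lemmas haar_measurable_cong [measurable_cong] = haar_sets[OF haar]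

lemma radial_measurable:
  fixes g :: "real \<Rightarrow> 'b::topological_space"
  shows "(\<lambda>x. g (padic_abs x)) \<in> borel_measurable M"
  using radial_borel_measurable measurable_cong_sets[OF haar_sets[OF haar] refl] by blast

lemma padic_hilbert_measurable: "padic_hilbert M f \<in> borel_measurable M"
  unfolding padic_hilbert_def[abs_def] hilbert_kernel_integrand_def by (rule radial_measurable)

text \<open>
  The norm only sees the profile: a bound \<open>K\<close> for it is a family of bounds for weighted \<open>l^r\<close> sums of
  the profile, the weights being the measures of \<open>B^l(a) \<inter> S_k\<close>.
\<close>

lemma cesaro_morrey_norm_le_iff:
  assumes r: "r \<ge> 1" and q: "q > 0" and K: "K \<ge> 0"
  shows "cesaro_morrey_norm M \<beta> r q f \<le> ennreal K \<longleftrightarrow>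
    (\<forall>a l. (\<integral>\<^sup>+k. ennreal_powr (cesaro_profile M \<beta> f k) r * emeasure M (padic_ball l a \<inter> padic_sphere k)
        \<partial>count_space UNIV) \<le> ennreal (K powr r * real CARD('p) powr (real_of_int l * (1 - r / q))))"
proof -
  let ?P = "real CARD('p)"
  have P: "?P > 1" by (rule CARD_gt_1)
  have "ennreal (measure M (padic_ball l a) powr (1 / q - 1 / r)) *
      ennreal_powr (\<integral>\<^sup>+x\<in>padic_ball l a. ennreal_powr (cesaro_mean M \<beta> f x) r \<partial>M) (1 / r) \<le> ennreal K
    \<longleftrightarrow> (\<integral>\<^sup>+k. ennreal_powr (cesaro_profile M \<beta> f k) r * emeasure M (padic_ball l a \<inter> padic_sphere k)
        \<partial>count_space UNIV) \<le> ennreal (K powr r * ?P powr (real_of_int l * (1 - r / q)))" for a l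
  proof -
    have int: "(\<integral>\<^sup>+x\<in>padic_ball l a. ennreal_powr (cesaro_mean M \<beta> f x) r \<partial>M) =
      (\<integral>\<^sup>+k. ennreal_powr (cesaro_profile M \<beta> f k) r * emeasure M (padic_ball l a \<inter> padic_sphere k)
        \<partial>count_space UNIV)"
    proof (rule nn_integral_radial[OF haar])
      show "(\<lambda>x. ennreal_powr (cesaro_mean M \<beta> f x) r) \<in> borel_measurable M"
        unfolding cesaro_mean_def[abs_def] by (rule radial_measurable)
    qed (simp_all add: padic_ball_sets[OF haar] cesaro_mean_on_sphere)
    have m: "measure M (padic_ball l a) powr (1 / q - 1 / r) = ?P powr (real_of_int l * (1 / q - 1 / r))"
      using P by (simp add: measure_def emeasure_padic_ball[OF haar] powi_CARD_powr powr_powr)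
    have "(K / ?P powr e) powr r = K powr r * ?P powr (- e * r)" for e
      using K by (simp add: powr_divide powr_powr powr_minus_divide)
    then have "(K / ?P powr (real_of_int l * (1 / q - 1 / r))) powr r
        = K powr r * ?P powr (- (real_of_int l * (1 / q - 1 / r)) * r)" .
    also have "- (real_of_int l * (1 / q - 1 / r)) * r = real_of_int l * (1 - r / q)"
      using r by (simp add: field_simps)
    finally show ?thesis
      unfolding int m using r K P
      by (subst ennreal_mult_le_iff_le_divide) (auto simp: ennreal_powr_le_iff)
  qed
  then show ?thesis unfolding cesaro_morrey_norm_def by (auto simp: SUP_le_iff)
qed

text \<open>
  Take the largest ball around a point of \<open>S_n\<close> that avoids zero.  It has radius \<open>p^(n-1)\<close>, and the
  Cesaro mean is constant on it, so the norm controls that constant.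
\<close>

lemma cesaro_profile_le:
  assumes r: "r \<ge> 1" and q: "q > 0" and K: "K \<ge> 0"
    and le: "cesaro_morrey_norm M \<beta> r q f \<le> ennreal K"
  shows "cesaro_profile M \<beta> f n \<le> ennreal (K * real CARD('p) powr ((1 - real_of_int n) / q))"
proof -
  let ?P = "real CARD('p)"
  have P: "?P > 1" by (rule CARD_gt_1)
  obtain a :: "'p padic" where a: "padic_abs a = ?P powi n"
    using padic_abs_of_value_exists by blast
  have m: "emeasure M (padic_ball (n - 1) a \<inter> padic_sphere n) = ennreal (?P powr real_of_int (n - 1))"
    using emeasure_ball_sphere_off_center[OF haar a, of "n - 1" n] by (simp add: powi_CARD_powr)
  have "ennreal (?P powr real_of_int (n - 1)) * ennreal_powr (cesaro_profile M \<beta> f n) r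
      \<le> (\<integral>\<^sup>+k. ennreal_powr (cesaro_profile M \<beta> f k) r * emeasure M (padic_ball (n - 1) a \<inter> padic_sphere k)
        \<partial>count_space UNIV)"
    unfolding m[symmetric] by (subst mult.commute) (rule nn_integral_ge_point, simp)
  also have "\<dots> \<le> ennreal (K powr r * ?P powr (real_of_int (n - 1) * (1 - r / q)))"
    using le cesaro_morrey_norm_le_iff[OF r q K] by blast
  finally have "ennreal_powr (cesaro_profile M \<beta> f n) r
      \<le> ennreal (K powr r * ?P powr (real_of_int (n - 1) * (1 - r / q)) / ?P powr real_of_int (n - 1))"
    using P K by (subst (asm) ennreal_mult_le_iff_le_divide) auto
  also have "K powr r * ?P powr (real_of_int (n - 1) * (1 - r / q)) / ?P powr real_of_int (n - 1)
      = K powr r * ?P powr (real_of_int (n - 1) * (1 - r / q) - real_of_int (n - 1))"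
    by (simp add: powr_diff)
  also have "real_of_int (n - 1) * (1 - r / q) - real_of_int (n - 1) = (1 - real_of_int n) / q * r"
    using q by (simp add: field_simps)
  also have "K powr r * ?P powr ((1 - real_of_int n) / q * r) = (K * ?P powr ((1 - real_of_int n) / q)) powr r"
    using K by (simp add: powr_mult powr_powr)
  finally show ?thesis
    using r K by (subst (asm) ennreal_powr_le_iff) (auto simp: powr_powr powr_mult)
qed

section \<open>The Hilbert operator on spheres\<close>

lemma nn_integral_centered_ball:
  assumes [measurable]: "h \<in> borel_measurable M"
  shows "(\<integral>\<^sup>+t\<in>padic_ball n 0. h t \<partial>M) =
    (\<integral>\<^sup>+i. (if i \<le> n then (\<integral>\<^sup>+t\<in>padic_sphere i. h t \<partial>M) else 0) \<partial>count_space UNIV)"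
proof -
  have [measurable]: "padic_ball n 0 \<in> sets M" by (rule padic_ball_sets[OF haar])
  have "(\<integral>\<^sup>+t\<in>padic_sphere i. (h t * indicator (padic_ball n 0) t) \<partial>M) =
      (if i \<le> n then (\<integral>\<^sup>+t\<in>padic_sphere i. h t \<partial>M) else 0)" for i
  proof (cases "i \<le> n")
    case True
    then have "padic_sphere i \<subseteq> (padic_ball n 0 :: 'p padic set)"
      by (auto simp: padic_sphere_def padic_ball_def)
    then show ?thesis using True by (auto intro!: nn_integral_cong simp: indicator_def)
  next
    case False
    then have "padic_sphere i \<inter> (padic_ball n 0 :: 'p padic set) = {}"
      by (auto simp: padic_sphere_def padic_ball_def)
    then have "(\<integral>\<^sup>+t\<in>padic_sphere i. (h t * indicator (padic_ball n 0) t) \<partial>M) = (\<integral>\<^sup>+t. 0 \<partial>M)"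
      by (intro nn_integral_cong) (auto simp: indicator_def)
    then show ?thesis using False by simp
  qed
  then show ?thesis by (subst nn_integral_padic_spheres[OF haar]) simp_all
qed

text \<open>
  On \<open>S_i \<times> S_k\<close> the kernel is the constant \<open>1 / (p^i + p^k)\<close>; the sum over \<open>i\<close> is reindexed by
  \<open>i = k + j\<close> so that the kernel splits into \<open>p^(-k)\<close> and a function of \<open>j\<close>.
\<close>

lemma nn_integral_hilbert_kernel:
  assumes [measurable]: "f \<in> borel_measurable M" and t: "t \<in> padic_sphere k"
  shows "(\<integral>\<^sup>+s\<in>{s. s \<noteq> 0}. ennreal (norm (hilbert_kernel_integrand f t s)) \<partial>M) =
    (\<integral>\<^sup>+j. ennreal (1 / (real CARD('p) powi k * (1 + real CARD('p) powi j))) *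
      (\<integral>\<^sup>+s\<in>padic_sphere (k + j). ennreal (norm (f s)) \<partial>M) \<partial>count_space UNIV)"
proof -
  let ?P = "real CARD('p)"
  have [measurable]: "padic_abs \<in> borel_measurable M" "\<And>i. padic_sphere i \<in> sets M"
    using radial_measurable[of "\<lambda>x. x"] padic_sphere_sets[OF haar] by auto
  have [measurable]: "{s. s \<noteq> 0} \<in> sets M"
    unfolding haar_sets[OF haar] by (intro borel_open open_Collect_neq continuous_intros)
  let ?g = "\<lambda>i. \<integral>\<^sup>+s\<in>padic_sphere i. ennreal (norm (f s)) \<partial>M"
  have sph: "(\<integral>\<^sup>+s\<in>padic_sphere i. (ennreal (norm (hilbert_kernel_integrand f t s)) * indicator {s. s \<noteq> 0} s) \<partial>M)
      = ennreal (1 / (?P powi i + ?P powi k)) * ?g i" for i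
  proof -
    have pos: "?P powi i + ?P powi k > 0" by (intro add_pos_pos) auto
    have "(\<integral>\<^sup>+s\<in>padic_sphere i. (ennreal (norm (hilbert_kernel_integrand f t s)) * indicator {s. s \<noteq> 0} s) \<partial>M)
      = (\<integral>\<^sup>+s. ennreal (1 / (?P powi i + ?P powi k)) * (ennreal (norm (f s)) * indicator (padic_sphere i) s) \<partial>M)"
    proof (rule nn_integral_cong)
      fix s :: "'p padic"
      show "ennreal (norm (hilbert_kernel_integrand f t s)) * indicator {s. s \<noteq> 0} s * indicator (padic_sphere i) s
        = ennreal (1 / (?P powi i + ?P powi k)) * (ennreal (norm (f s)) * indicator (padic_sphere i) s)"
      proof (cases "s \<in> padic_sphere i")
        case True
        then have s: "padic_abs s = ?P powi i" "s \<noteq> 0"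
          using zero_notin_padic_sphere by (auto simp: padic_sphere_def)
        have tk: "padic_abs t = ?P powi k" using t by (simp add: padic_sphere_def)
        have "norm (hilbert_kernel_integrand f t s) = norm (f s) / \<bar>?P powi i + ?P powi k\<bar>"
          unfolding hilbert_kernel_integrand_def s tk norm_divide norm_of_real ..
        also have "\<dots> = 1 / (?P powi i + ?P powi k) * norm (f s)" using pos by simp
        finally have "norm (hilbert_kernel_integrand f t s) = 1 / (?P powi i + ?P powi k) * norm (f s)" .
        then show ?thesis using True s pos by (simp only:) (simp add: ennreal_mult less_imp_le del: times_divide_eq_left)
      qed simp
    qed
    also have "\<dots> = ennreal (1 / (?P powi i + ?P powi k)) * ?g i"
      by (rule nn_integral_cmult) measurable
    finally show ?thesis .
  qed
  have "(\<integral>\<^sup>+s\<in>{s. s \<noteq> 0}. ennreal (norm (hilbert_kernel_integrand f t s)) \<partial>M) =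
      (\<integral>\<^sup>+i. ennreal (1 / (?P powi i + ?P powi k)) * ?g i \<partial>count_space UNIV)"
    unfolding sph[symmetric]
    by (rule nn_integral_padic_spheres[OF haar]) (unfold hilbert_kernel_integrand_def, measurable)
  also have "\<dots> = (\<integral>\<^sup>+j. ennreal (1 / (?P powi (j + k) + ?P powi k)) * ?g (j + k) \<partial>count_space UNIV)"
    by (rule nn_integral_int_shift[symmetric])
  finally show ?thesis by (simp add: powi_CARD_add algebra_simps)
qed

text \<open>
  Inverts the definition of the profile: up to a power of \<open>p\<close>, it is the mass of \<open>f\<close> on the centered
  ball.
\<close>

lemma ball_mass_eq_cesaro_profile:
  "(\<integral>\<^sup>+t\<in>padic_ball n 0. ennreal (norm (f t)) \<partial>M) =
     ennreal (real CARD('p) powr (real_of_int n * (1 - \<beta>))) * cesaro_profile M \<beta> f n"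
  unfolding cesaro_profile_def mult.assoc[symmetric]
  by (simp add: powr_add[symmetric] flip: ennreal_mult)

text \<open>
  The heart of the argument.  In the mass of \<open>\<H> f\<close> on \<open>S_k\<close> the measure \<open>p^k (1 - 1/p)\<close> of the
  sphere cancels the factor \<open>p^(-k)\<close> of the kernel, leaving
  \<open>(1 - 1/p) \<Sum>j. g (k + j) / (1 + p^j)\<close> with \<open>g i\<close> the mass of \<open>f\<close> on \<open>S_i\<close>.  Summing over \<open>k \<le> n\<close> and
  interchanging the sums, the inner sum of \<open>g (k + j)\<close> is the mass of \<open>f\<close> on the ball of radius
  \<open>p^(n+j)\<close>, that is, a value of the profile of \<open>f\<close>.
\<close>

lemma cesaro_profile_hilbert_le:
  assumes f [measurable]: "f \<in> borel_measurable M"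
  shows "cesaro_profile M \<beta> (padic_hilbert M f) n \<le>
    (\<integral>\<^sup>+j. ennreal (dilation_weight CARD('p) \<beta> j) * cesaro_profile M \<beta> f (n + j) \<partial>count_space UNIV)"
proof -
  let ?P = "real CARD('p)"
  have P: "?P > 1" by (rule CARD_gt_1)
  let ?g = "\<lambda>i. \<integral>\<^sup>+s\<in>padic_sphere i. ennreal (norm (f s)) \<partial>M"
  define I where "I k = (\<integral>\<^sup>+j. ennreal (1 / (?P powi k * (1 + ?P powi j))) * ?g (k + j) \<partial>count_space UNIV)" for k
  have pt: "ennreal (norm (padic_hilbert M f t)) \<le> I k" if t: "t \<in> padic_sphere k" for t k
  proof -
    have "ennreal (norm (padic_hilbert M f t)) \<le>
        (\<integral>\<^sup>+s. ennreal (norm (indicator {s. s \<noteq> 0} s *\<^sub>R hilbert_kernel_integrand f t s)) \<partial>M)"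
    \<comment> \<open>Where the integrand is not integrable, the Bochner integral is 0 and the bound is trivial.\<close>
    proof (cases "integrable M (\<lambda>s. indicator {s. s \<noteq> 0} s *\<^sub>R hilbert_kernel_integrand f t s)")
      case True
      then show ?thesis unfolding padic_hilbert_def set_lebesgue_integral_def
        by (rule integral_norm_bound_ennreal)
    next
      case False
      then show ?thesis
        unfolding padic_hilbert_def set_lebesgue_integral_def by (simp add: not_integrable_integral_eq)
    qed
    also have "\<dots> = (\<integral>\<^sup>+s\<in>{s. s \<noteq> 0}. ennreal (norm (hilbert_kernel_integrand f t s)) \<partial>M)"
      by (intro nn_integral_cong) (auto simp: indicator_def)
    also have "\<dots> = I k" unfolding I_def by (rule nn_integral_hilbert_kernel[OF f t])
    finally show ?thesis .
  qed
  have sphere: "(\<integral>\<^sup>+t\<in>padic_sphere k. ennreal (norm (padic_hilbert M f t)) \<partial>M) \<le>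
      (\<integral>\<^sup>+j. ennreal ((1 - 1 / ?P) / (1 + ?P powi j)) * ?g (k + j) \<partial>count_space UNIV)" for k
  proof -
    have "(\<integral>\<^sup>+t\<in>padic_sphere k. ennreal (norm (padic_hilbert M f t)) \<partial>M) \<le>
        (\<integral>\<^sup>+t. I k * indicator (padic_sphere k) t \<partial>M)"
      using pt by (intro nn_integral_mono) (auto simp: indicator_def)
    also have "\<dots> = ennreal (?P powi k * (1 - 1 / ?P)) * I k"
      by (simp add: nn_integral_cmult_indicator padic_sphere_sets[OF haar] emeasure_padic_sphere[OF haar] mult.commute)
    also have "\<dots> = (\<integral>\<^sup>+j. ennreal (?P powi k * (1 - 1 / ?P)) *
        (ennreal (1 / (?P powi k * (1 + ?P powi j))) * ?g (k + j)) \<partial>count_space UNIV)"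
      unfolding I_def by (rule nn_integral_cmult[symmetric]) simp
    also have "\<dots> = (\<integral>\<^sup>+j. ennreal ((1 - 1 / ?P) / (1 + ?P powi j)) * ?g (k + j) \<partial>count_space UNIV)"
    proof (rule nn_integral_cong)
      fix j
      have "?P powi k * (1 - 1 / ?P) * (1 / (?P powi k * (1 + ?P powi j))) = (1 - 1 / ?P) / (1 + ?P powi j)"
        using P by simp
      moreover have "0 \<le> ?P powi k * (1 - 1 / ?P)" "0 \<le> 1 / (?P powi k * (1 + ?P powi j))"
        using P by (auto intro!: mult_nonneg_nonneg divide_nonneg_nonneg add_nonneg_nonneg simp: less_imp_le)
      ultimately show "ennreal (?P powi k * (1 - 1 / ?P)) * (ennreal (1 / (?P powi k * (1 + ?P powi j))) * ?g (k + j))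
          = ennreal ((1 - 1 / ?P) / (1 + ?P powi j)) * ?g (k + j)"
        by (simp only: mult.assoc[symmetric] flip: ennreal_mult)
    qed
    finally show ?thesis .
  qed
  have "(\<integral>\<^sup>+t\<in>padic_ball n 0. ennreal (norm (padic_hilbert M f t)) \<partial>M) =
      (\<integral>\<^sup>+k. (if k \<le> n then (\<integral>\<^sup>+t\<in>padic_sphere k. ennreal (norm (padic_hilbert M f t)) \<partial>M) else 0) \<partial>count_space UNIV)"
    using padic_hilbert_measurable by (intro nn_integral_centered_ball) simp
  also have "\<dots> \<le> (\<integral>\<^sup>+k. (\<integral>\<^sup>+j. ennreal ((1 - 1 / ?P) / (1 + ?P powi j)) * (if k \<le> n then ?g (k + j) else 0)
      \<partial>count_space UNIV) \<partial>count_space UNIV)"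
    using sphere by (intro nn_integral_mono) auto
  also have "\<dots> = (\<integral>\<^sup>+j. (\<integral>\<^sup>+k. ennreal ((1 - 1 / ?P) / (1 + ?P powi j)) * (if k \<le> n then ?g (k + j) else 0)
      \<partial>count_space UNIV) \<partial>count_space UNIV)"
    by (rule nn_integral_count_space_nn_integral) auto
  also have "\<dots> = (\<integral>\<^sup>+j. ennreal ((1 - 1 / ?P) / (1 + ?P powi j)) *
      (\<integral>\<^sup>+t\<in>padic_ball (n + j) 0. ennreal (norm (f t)) \<partial>M) \<partial>count_space UNIV)"
  proof (rule nn_integral_cong)
    fix j
    have "(\<integral>\<^sup>+t\<in>padic_ball (n + j) 0. ennreal (norm (f t)) \<partial>M) =
        (\<integral>\<^sup>+i. (if i \<le> n + j then ?g i else 0) \<partial>count_space UNIV)"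
      by (rule nn_integral_centered_ball) measurable
    also have "\<dots> = (\<integral>\<^sup>+k. (if k + j \<le> n + j then ?g (k + j) else 0) \<partial>count_space UNIV)"
      by (rule nn_integral_int_shift[symmetric])
    finally show "(\<integral>\<^sup>+k. ennreal ((1 - 1 / ?P) / (1 + ?P powi j)) * (if k \<le> n then ?g (k + j) else 0) \<partial>count_space UNIV)
        = ennreal ((1 - 1 / ?P) / (1 + ?P powi j)) * (\<integral>\<^sup>+t\<in>padic_ball (n + j) 0. ennreal (norm (f t)) \<partial>M)"
      by (simp add: nn_integral_cmult)
  qed
  finally have "cesaro_profile M \<beta> (padic_hilbert M f) n \<le>
      ennreal (?P powr (- (real_of_int n * (1 - \<beta>)))) *
      (\<integral>\<^sup>+j. ennreal ((1 - 1 / ?P) / (1 + ?P powi j)) *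
        (\<integral>\<^sup>+t\<in>padic_ball (n + j) 0. ennreal (norm (f t)) \<partial>M) \<partial>count_space UNIV)"
    unfolding cesaro_profile_def by (intro mult_left_mono) auto
  also have "\<dots> = (\<integral>\<^sup>+j. ennreal (?P powr (- (real_of_int n * (1 - \<beta>)))) * (ennreal ((1 - 1 / ?P) / (1 + ?P powi j)) *
        (\<integral>\<^sup>+t\<in>padic_ball (n + j) 0. ennreal (norm (f t)) \<partial>M)) \<partial>count_space UNIV)"
    by (rule nn_integral_cmult[symmetric]) simp
  also have "\<dots> = (\<integral>\<^sup>+j. ennreal (dilation_weight CARD('p) \<beta> j) * cesaro_profile M \<beta> f (n + j) \<partial>count_space UNIV)"
  proof (rule nn_integral_cong)
    fix j
    let ?c = "(1 - 1 / ?P) / (1 + ?P powi j)"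
    have c: "?c \<ge> 0"
      using P by (auto intro!: divide_nonneg_nonneg add_nonneg_nonneg simp: less_imp_le)
    have "?P powr (- (real_of_int n * (1 - \<beta>))) * (?c * ?P powr (real_of_int (n + j) * (1 - \<beta>)))
        = ?c * (?P powr (- (real_of_int n * (1 - \<beta>))) * ?P powr (real_of_int (n + j) * (1 - \<beta>)))"
      by (simp only: mult_ac)
    also have "\<dots> = ?c * ?P powr (- (real_of_int n * (1 - \<beta>)) + real_of_int (n + j) * (1 - \<beta>))"
      by (simp only: powr_add)
    also have "- (real_of_int n * (1 - \<beta>)) + real_of_int (n + j) * (1 - \<beta>) = real_of_int j * (1 - \<beta>)"
      by (simp add: algebra_simps)
    finally have *: "?P powr (- (real_of_int n * (1 - \<beta>))) * (?c * ?P powr (real_of_int (n + j) * (1 - \<beta>)))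
        = dilation_weight CARD('p) \<beta> j" by (simp add: dilation_weight_def)
    show "ennreal (?P powr (- (real_of_int n * (1 - \<beta>)))) * (ennreal ?c *
        (\<integral>\<^sup>+t\<in>padic_ball (n + j) 0. ennreal (norm (f t)) \<partial>M))
        = ennreal (dilation_weight CARD('p) \<beta> j) * cesaro_profile M \<beta> f (n + j)"
      unfolding *[symmetric] ball_mass_eq_cesaro_profile[where n = "n + j" and \<beta> = \<beta>]
      using c by (simp only: ennreal_mult mult_nonneg_nonneg powr_ge_zero mult.assoc)
  qed
  finally show ?thesis .
qed


text \<open>
  The pointwise bound of \<open>cesaro_profile_le\<close> decays like \<open>p^(-n/q)\<close>, which makes the series of dilates
  a multiple of the series defining the constant.
\<close>

lemma cesaro_profile_hilbert_finite:
  assumes q: "q > 0" and \<theta>: "0 < 1 - \<beta> - 1 / q" "1 - \<beta> - 1 / q < 1" and K: "K \<ge> 0"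
    and le: "\<And>n. cesaro_profile M \<beta> f n \<le> ennreal (K * real CARD('p) powr ((1 - real_of_int n) / q))"
  shows "(\<integral>\<^sup>+j. ennreal (dilation_weight CARD('p) \<beta> j) * cesaro_profile M \<beta> f (n + j) \<partial>count_space UNIV) < \<infinity>"
proof -
  let ?P = "real CARD('p)"
  have P: "?P > 1" by (rule CARD_gt_1)
  let ?c = "K * ?P powr ((1 - real_of_int n) / q)"
  have "(\<integral>\<^sup>+j. ennreal (dilation_weight CARD('p) \<beta> j) * cesaro_profile M \<beta> f (n + j) \<partial>count_space UNIV) \<le>
      (\<integral>\<^sup>+j. ennreal ?c * ennreal ((1 - 1 / ?P) * hilbert_const_term CARD('p) \<beta> q j) \<partial>count_space UNIV)"
  proof (rule nn_integral_mono)
    fix j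
    have "(1 - real_of_int (n + j)) / q = (1 - real_of_int n) / q + - real_of_int j / q"
      using q by (simp add: field_simps)
    then have "dilation_weight CARD('p) \<beta> j * (K * ?P powr ((1 - real_of_int (n + j)) / q))
        = ?c * (dilation_weight CARD('p) \<beta> j * ?P powr (- real_of_int j / q))"
      by (simp only: powr_add mult_ac)
    also have "\<dots> = ?c * ((1 - 1 / ?P) * hilbert_const_term CARD('p) \<beta> q j)"
      unfolding dilation_weight_hilbert_const ..
    finally have eq: "dilation_weight CARD('p) \<beta> j * (K * ?P powr ((1 - real_of_int (n + j)) / q))
        = ?c * ((1 - 1 / ?P) * hilbert_const_term CARD('p) \<beta> q j)" .
    have "ennreal (dilation_weight CARD('p) \<beta> j) * cesaro_profile M \<beta> f (n + j)
        \<le> ennreal (dilation_weight CARD('p) \<beta> j) * ennreal (K * ?P powr ((1 - real_of_int (n + j)) / q))"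
      by (intro mult_left_mono le) auto
    also have "\<dots> = ennreal (dilation_weight CARD('p) \<beta> j * (K * ?P powr ((1 - real_of_int (n + j)) / q)))"
      using K by (intro ennreal_mult[symmetric]) (auto simp: dilation_weight_nonneg)
    also have "\<dots> = ennreal ?c * ennreal ((1 - 1 / ?P) * hilbert_const_term CARD('p) \<beta> q j)"
      unfolding eq using K P by (intro ennreal_mult) (auto simp: hilbert_const_term_nonneg)
    finally show "ennreal (dilation_weight CARD('p) \<beta> j) * cesaro_profile M \<beta> f (n + j)
        \<le> ennreal ?c * ennreal ((1 - 1 / ?P) * hilbert_const_term CARD('p) \<beta> q j)" .
  qed
  also have "\<dots> = ennreal ?c * ennreal (hilbert_const CARD('p) \<beta> q)"
    by (simp add: nn_integral_cmult nn_integral_hilbert_const[OF P \<theta>])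
  also have "\<dots> < \<infinity>" by (simp add: ennreal_mult_less_top)
  finally show ?thesis .
qed

text \<open>
  For \<open>t\<close> in \<open>S_k\<close> the series for the integral of the modulus is at most a multiple of the series of
  dilates at \<open>k\<close>: enlarge the mass of \<open>f\<close> on each sphere to its mass on the ball of the same radius.
\<close>

lemma set_integrable_hilbert_kernel:
  assumes f [measurable]: "f \<in> borel_measurable M" and t: "t \<noteq> 0"
    and fin: "\<And>n. (\<integral>\<^sup>+j. ennreal (dilation_weight CARD('p) \<beta> j) * cesaro_profile M \<beta> f (n + j) \<partial>count_space UNIV) < \<infinity>"
  shows "set_integrable M {s. s \<noteq> 0} (hilbert_kernel_integrand f t)"
proof -
  let ?P = "real CARD('p)"
  have P: "?P > 1" by (rule CARD_gt_1)
  let ?g = "\<lambda>i. \<integral>\<^sup>+s\<in>padic_sphere i. ennreal (norm (f s)) \<partial>M"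
  obtain k where k: "t \<in> padic_sphere k" using padic_nonzero_in_sphere[OF t] by blast
  define c where "c = ?P powr (real_of_int k * (1 - \<beta>)) / (?P powi k * (1 - 1 / ?P))"
  have c: "c \<ge> 0" unfolding c_def using P by (intro divide_nonneg_nonneg mult_nonneg_nonneg) auto
  have "(\<integral>\<^sup>+s\<in>{s. s \<noteq> 0}. ennreal (norm (hilbert_kernel_integrand f t s)) \<partial>M) \<le>
      (\<integral>\<^sup>+j. ennreal c * (ennreal (dilation_weight CARD('p) \<beta> j) * cesaro_profile M \<beta> f (k + j)) \<partial>count_space UNIV)"
    unfolding nn_integral_hilbert_kernel[OF f k]
  proof (rule nn_integral_mono)
    fix j
    have g: "?g (k + j) \<le> (\<integral>\<^sup>+t\<in>padic_ball (k + j) 0. ennreal (norm (f t)) \<partial>M)"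
      by (intro nn_integral_mono mult_left_mono) (auto simp: indicator_def padic_sphere_def padic_ball_def)
    have "?P powr (real_of_int (k + j) * (1 - \<beta>)) = ?P powr (real_of_int k * (1 - \<beta>)) * ?P powr (real_of_int j * (1 - \<beta>))"
      by (simp add: powr_add[symmetric] algebra_simps)
    then have eq: "1 / (?P powi k * (1 + ?P powi j)) * ?P powr (real_of_int (k + j) * (1 - \<beta>)) = c * dilation_weight CARD('p) \<beta> j"
      unfolding c_def dilation_weight_def using P by simp
    have nn: "0 \<le> 1 / (?P powi k * (1 + ?P powi j))"
      by (intro divide_nonneg_nonneg mult_nonneg_nonneg add_nonneg_nonneg) auto
    have "ennreal (1 / (?P powi k * (1 + ?P powi j))) * ?g (k + j) \<le> ennreal (1 / (?P powi k * (1 + ?P powi j))) *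
        (ennreal (?P powr (real_of_int (k + j) * (1 - \<beta>))) * cesaro_profile M \<beta> f (k + j))"
      using g unfolding ball_mass_eq_cesaro_profile[where n = "k + j" and \<beta> = \<beta>] by (rule mult_left_mono) simp
    also have "\<dots> = ennreal (c * dilation_weight CARD('p) \<beta> j) * cesaro_profile M \<beta> f (k + j)"
      unfolding eq[symmetric] using nn by (simp only: ennreal_mult powr_ge_zero mult.assoc)
    also have "\<dots> = ennreal c * (ennreal (dilation_weight CARD('p) \<beta> j) * cesaro_profile M \<beta> f (k + j))"
      using c by (simp add: ennreal_mult dilation_weight_nonneg mult.assoc)
    finally show "ennreal (1 / (?P powi k * (1 + ?P powi j))) * ?g (k + j)
        \<le> ennreal c * (ennreal (dilation_weight CARD('p) \<beta> j) * cesaro_profile M \<beta> f (k + j))" .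
  qed
  also have "\<dots> = ennreal c * (\<integral>\<^sup>+j. ennreal (dilation_weight CARD('p) \<beta> j) * cesaro_profile M \<beta> f (k + j) \<partial>count_space UNIV)"
    by (rule nn_integral_cmult) simp
  also have "\<dots> < \<infinity>" using fin[of k] by (simp add: ennreal_mult_less_top)
  finally have lt: "(\<integral>\<^sup>+s\<in>{s. s \<noteq> 0}. ennreal (norm (hilbert_kernel_integrand f t s)) \<partial>M) < \<infinity>" .
  have [measurable]: "padic_abs \<in> borel_measurable M" using radial_measurable[of "\<lambda>x. x"] by simp
  have [measurable]: "{s. s \<noteq> 0} \<in> sets M"
    unfolding haar_sets[OF haar] by (intro borel_open open_Collect_neq continuous_intros)
  show ?thesis unfolding set_integrable_def
  proof (rule integrableI_bounded)
    show "(\<lambda>s. indicator {s. s \<noteq> 0} s *\<^sub>R hilbert_kernel_integrand f t s) \<in> borel_measurable M"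
      unfolding hilbert_kernel_integrand_def by measurable
    have "(\<integral>\<^sup>+s. ennreal (norm (indicator {s. s \<noteq> 0} s *\<^sub>R hilbert_kernel_integrand f t s)) \<partial>M)
        = (\<integral>\<^sup>+s\<in>{s. s \<noteq> 0}. ennreal (norm (hilbert_kernel_integrand f t s)) \<partial>M)"
      by (intro nn_integral_cong) (auto simp: indicator_def)
    then show "(\<integral>\<^sup>+s. ennreal (norm (indicator {s. s \<noteq> 0} s *\<^sub>R hilbert_kernel_integrand f t s)) \<partial>M) < \<infinity>"
      using lt by simp
  qed
qed

text \<open>
  The bound for \<open>B^(l+j)(c)\<close>, with \<open>c\<close> a dilate of \<open>a\<close>, becomes a bound for the shifted profile on
  \<open>B^l(a)\<close> after division by \<open>p^j\<close>.
\<close>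

lemma weighted_profile_dilate:
  assumes c: "padic_abs c = real CARD('p) powi j * padic_abs a"
    and le: "(\<integral>\<^sup>+k. \<Phi> k * emeasure M (padic_ball (l + j) c \<inter> padic_sphere k) \<partial>count_space UNIV) \<le> ennreal B"
    and B: "B \<ge> 0"
  shows "(\<integral>\<^sup>+k. \<Phi> (k + j) * emeasure M (padic_ball l a \<inter> padic_sphere k) \<partial>count_space UNIV)
    \<le> ennreal (B / real CARD('p) powi j)"
proof -
  have "ennreal (real CARD('p) powi j) * (\<integral>\<^sup>+k. \<Phi> (k + j) * emeasure M (padic_ball l a \<inter> padic_sphere k) \<partial>count_space UNIV)
      = (\<integral>\<^sup>+k. ennreal (real CARD('p) powi j) * (\<Phi> (k + j) * emeasure M (padic_ball l a \<inter> padic_sphere k)) \<partial>count_space UNIV)"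
    by (rule nn_integral_cmult[symmetric]) simp
  also have "\<dots> = (\<integral>\<^sup>+k. \<Phi> (k + j) * emeasure M (padic_ball (l + j) c \<inter> padic_sphere (k + j)) \<partial>count_space UNIV)"
    unfolding emeasure_ball_sphere_dilate[OF haar c] by (simp only: mult.left_commute)
  also have "\<dots> = (\<integral>\<^sup>+k. \<Phi> k * emeasure M (padic_ball (l + j) c \<inter> padic_sphere k) \<partial>count_space UNIV)"
    by (rule nn_integral_int_shift)
  also note le
  finally show ?thesis using B by (subst (asm) ennreal_mult_le_iff_le_divide) auto
qed

text \<open>
  Minkowski's inequality for the superposition of dilates, on each ball separately.  The profile is
  a function on the integers, which carry the measure whose density is the measure of
  \<open>B^l(a) \<inter> S_k\<close>.
\<close>

lemma cesaro_morrey_norm_hilbert_le: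
  assumes r: "r \<ge> 1" and q: "q > 0" and \<theta>: "0 < 1 - \<beta> - 1 / q" "1 - \<beta> - 1 / q < 1"
    and K: "K \<ge> 0" and f: "f \<in> borel_measurable M"
    and le: "cesaro_morrey_norm M \<beta> r q f \<le> ennreal K"
  shows "cesaro_morrey_norm M \<beta> r q (padic_hilbert M f) \<le> ennreal (hilbert_const CARD('p) \<beta> q * K)"
proof -
  let ?P = "real CARD('p)" and ?C = "hilbert_const CARD('p) \<beta> q"
  have P: "?P > 1" by (rule CARD_gt_1)
  have C: "?C > 0" by (rule hilbert_const_pos[OF P \<theta>])
  note bound = cesaro_profile_le[OF r q K le]
  note fin = cesaro_profile_hilbert_finite[OF q \<theta> K bound]
  define \<phi> where "\<phi> n = enn2real (cesaro_profile M \<beta> f n)" for n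
  have \<phi>: "cesaro_profile M \<beta> f n = ennreal (\<phi> n)" "\<phi> n \<ge> 0" for n
    using bound[of n] by (auto simp: \<phi>_def ennreal_enn2real_if top_unique)
  define S where "S n = enn2real (\<integral>\<^sup>+j. ennreal (dilation_weight CARD('p) \<beta> j) * cesaro_profile M \<beta> f (n + j) \<partial>count_space UNIV)" for n
  have S: "(\<integral>\<^sup>+j. ennreal (dilation_weight CARD('p) \<beta> j) * cesaro_profile M \<beta> f (n + j) \<partial>count_space UNIV) = ennreal (S n)" "S n \<ge> 0" for n
    using fin[of n] by (auto simp: S_def ennreal_enn2real_if)
  show ?thesis
  proof (subst cesaro_morrey_norm_le_iff[OF r q], use C K in simp, intro allI)
    fix a :: "'p padic" and l :: int
    define w where "w k = emeasure M (padic_ball l a \<inter> padic_sphere k)" for k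
    define R where "R = ennreal (K powr r * ?P powr (real_of_int l * (1 - r / q)))"
    have dens: "(\<integral>\<^sup>+k. h k \<partial>density (count_space UNIV) w) = (\<integral>\<^sup>+k. h k * w k \<partial>count_space UNIV)" for h
      by (subst nn_integral_density) (auto simp: mult.commute)
    have "(\<integral>\<^sup>+k. ennreal_powr (cesaro_profile M \<beta> (padic_hilbert M f) k) r * w k \<partial>count_space UNIV)
        \<le> (\<integral>\<^sup>+k. ennreal (S k powr r) \<partial>density (count_space UNIV) w)"
      unfolding dens
    proof (intro nn_integral_mono mult_right_mono)
      fix k
      have "ennreal_powr (cesaro_profile M \<beta> (padic_hilbert M f) k) r \<le> ennreal_powr (ennreal (S k)) r"
        using cesaro_profile_hilbert_le[OF f, of \<beta> k] r unfolding S by (intro ennreal_powr_mono) auto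
      then show "ennreal_powr (cesaro_profile M \<beta> (padic_hilbert M f) k) r \<le> ennreal (S k powr r)"
        by (simp add: ennreal_powr_ennreal S(2))
    qed simp
    also have "\<dots> \<le> ennreal (?C powr r) * R"
    proof (rule Minkowski_countable_sum[OF r, where \<Phi> = "\<lambda>j k. \<phi> (k + j)" and d = "dilation_weight CARD('p) \<beta>"
          and b = "\<lambda>j. ?P powr (- real_of_int j / q)"])
      show "(\<integral>\<^sup>+j. ennreal (dilation_weight CARD('p) \<beta> j * ?P powr (- real_of_int j / q)) \<partial>count_space UNIV) = ennreal ?C"
        unfolding dilation_weight_hilbert_const by (rule nn_integral_hilbert_const[OF P \<theta>])
      show "(\<integral>\<^sup>+j. ennreal (dilation_weight CARD('p) \<beta> j * \<phi> (k + j)) \<partial>count_space UNIV) = ennreal (S k)" for k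
        unfolding S(1)[symmetric] \<phi>(1) using \<phi>(2) by (simp add: ennreal_mult dilation_weight_nonneg)
      fix j
      \<comment> \<open>Dilating \<open>B^l(a)\<close> by \<open>u\<close> gives \<open>B^(l+j)(u a)\<close>, another ball of the supremum.\<close>
      obtain u :: "'p padic" where u: "padic_abs u = ?P powi j" using padic_abs_of_value_exists by blast
      have "(\<integral>\<^sup>+k. ennreal (\<phi> k powr r) * emeasure M (padic_ball (l + j) (u * a) \<inter> padic_sphere k) \<partial>count_space UNIV)
          \<le> ennreal (K powr r * ?P powr (real_of_int (l + j) * (1 - r / q)))"
        using le[unfolded cesaro_morrey_norm_le_iff[OF r q K], THEN spec[of _ "u * a"], THEN spec[of _ "l + j"]]
        by (simp only: \<phi> ennreal_powr_ennreal)
      from weighted_profile_dilate[OF _ this, of a]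
      have "(\<integral>\<^sup>+k. ennreal (\<phi> (k + j) powr r) * w k \<partial>count_space UNIV)
          \<le> ennreal (K powr r * ?P powr (real_of_int (l + j) * (1 - r / q)) / ?P powi j)"
        unfolding w_def by (simp add: padic_abs_mult u)
      also have "K powr r * ?P powr (real_of_int (l + j) * (1 - r / q)) / ?P powi j
          = K powr r * ?P powr (real_of_int (l + j) * (1 - r / q) - real_of_int j)"
        by (simp add: powi_CARD_powr powr_diff)
      also have "real_of_int (l + j) * (1 - r / q) - real_of_int j = - real_of_int j / q * r + real_of_int l * (1 - r / q)"
        using q by (simp add: field_simps)
      also have "K powr r * ?P powr (- real_of_int j / q * r + real_of_int l * (1 - r / q))
          = (?P powr (- real_of_int j / q)) powr r * (K powr r * ?P powr (real_of_int l * (1 - r / q)))"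
        by (simp only: powr_add powr_powr mult_ac)
      finally show "(\<integral>\<^sup>+k. ennreal (\<phi> (k + j) powr r) \<partial>density (count_space UNIV) w)
          \<le> ennreal ((?P powr (- real_of_int j / q)) powr r) * R"
        unfolding dens R_def by (simp add: ennreal_mult)
    qed (use C P S \<phi> in \<open>auto simp: dilation_weight_nonneg\<close>)
    also have "\<dots> = ennreal ((?C * K) powr r * ?P powr (real_of_int l * (1 - r / q)))"
      unfolding R_def using C K by (simp add: powr_mult ennreal_mult mult.assoc)
    finally show "(\<integral>\<^sup>+k. ennreal_powr (cesaro_profile M \<beta> (padic_hilbert M f) k) r *
        emeasure M (padic_ball l a \<inter> padic_sphere k) \<partial>count_space UNIV)
        \<le> ennreal ((?C * K) powr r * ?P powr (real_of_int l * (1 - r / q)))"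
      unfolding w_def .
  qed
qed

end

theorem theorem16:
  fixes M :: "'p::prime_card padic measure"
    and \<beta> r q :: real
    and f :: "'p padic \<Rightarrow> complex"
  assumes "normalized_haar M"
    and "1 \<le> r" and "r \<le> q"
    and "0 \<le> \<beta>" and "\<beta> < 1 - 1 / q"
    and "f \<in> cesaro_morrey_space M \<beta> r q"
  shows "hilbert_const_term CARD('p) \<beta> q summable_on UNIV \<and>
    (\<forall>t. t \<noteq> 0 \<longrightarrow> set_integrable M {s. s \<noteq> 0} (hilbert_kernel_integrand f t)) \<and>
    padic_hilbert M f \<in> borel_measurable M \<and>
    cesaro_morrey_norm M \<beta> r q (padic_hilbert M f)
      \<le> ennreal (hilbert_const CARD('p) \<beta> q) * cesaro_morrey_norm M \<beta> r q f"
proof -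
  note haar = assms(1) and r = assms(2)
  have q: "q > 0" using assms(2,3) by simp
  have P: "real CARD('p) > 1" by (rule CARD_gt_1)
  have "1 / q > 0" using q by simp
  then have \<theta>: "0 < 1 - \<beta> - 1 / q" "1 - \<beta> - 1 / q < 1"
    using assms(4,5) by linarith+
  have f: "f \<in> borel_measurable M" and fin: "cesaro_morrey_norm M \<beta> r q f < \<infinity>"
    using assms(6) by (auto simp: cesaro_morrey_space_def locally_integrable_def)
  define K where "K = enn2real (cesaro_morrey_norm M \<beta> r q f)"
  have K: "K \<ge> 0" "cesaro_morrey_norm M \<beta> r q f = ennreal K"
    using fin by (auto simp: K_def ennreal_enn2real_if)
  have le: "cesaro_morrey_norm M \<beta> r q f \<le> ennreal K" using K by simp
  note series_finite = cesaro_profile_hilbert_finite[OF haar q \<theta> K(1) cesaro_profile_le[OF haar r q K(1) le]]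
  have "cesaro_morrey_norm M \<beta> r q (padic_hilbert M f) \<le> ennreal (hilbert_const CARD('p) \<beta> q * K)"
    by (rule cesaro_morrey_norm_hilbert_le[OF haar r q \<theta> K(1) f le])
  also have "\<dots> = ennreal (hilbert_const CARD('p) \<beta> q) * cesaro_morrey_norm M \<beta> r q f"
    unfolding K(2) using K(1) hilbert_const_pos[OF P \<theta>] by (simp add: ennreal_mult)
  finally have norm_le: "cesaro_morrey_norm M \<beta> r q (padic_hilbert M f)
      \<le> ennreal (hilbert_const CARD('p) \<beta> q) * cesaro_morrey_norm M \<beta> r q f" .
  have "set_integrable M {s. s \<noteq> 0} (hilbert_kernel_integrand f t)" if "t \<noteq> 0" for t
    by (rule set_integrable_hilbert_kernel[OF haar f that series_finite])
  then show ?thesis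
    by (intro conjI allI impI hilbert_const_term_summable[OF P \<theta>]
        padic_hilbert_measurable[OF haar] norm_le)
qed

end
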